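(* Let $H=H_\omega$ be a weighted analytic Hilbert space and $\varphi\in H$ an analytic self-map of $\mathbb{D}$ with $\|\varphi\|_\infty<1$. Then $$\liminf_{n\to\infty}[a_n(C_\varphi)]^{1/n}\ge\exp\big(-1/\operatorname{Cap}[\varphi(\mathbb{D})]\big).$$
   Context: Weighted analytic Hilbert space: $\omega\colon[0,1)\to(0,\infty)$ continuous, positive, integrable, extended radially; $H_\omega$ is the space of analytic $f$ on $\mathbb{D}$ with $\|f\|_\omega^2=|f(0)|^2+\int_{\mathbb{D}}|f'|^2\omega\,dA<\infty$ ($dA$ normalized area measure). $C_\varphi f=f\circ\varphi$ (bounded on $H$ under these hypotheses). $a_n(T)=\inf\{\|T-R\|:\operatorname{rank}R<n\}$. Green capacity: $g(z,w)=\log\left|\frac{1-\bar wz}{z-w}\right|$, $I(\mu)=\iint g\,d\mu\,d\mu$, $V(E)=\inf I(\mu)$ over probability measures supported by a compact subset of $E$, $\operatorname{Cap}(E)=1/V(E)$. *)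

theory Defs
  imports "HOL-Analysis.Analysis" "HOL-Probability.Probability"
begin

abbreviation unit_disc :: "complex set" where
  "unit_disc \<equiv> ball 0 1"

definition admissible_weight :: "(real \<Rightarrow> real) \<Rightarrow> bool" where
  "admissible_weight \<omega> \<longleftrightarrow>
     continuous_on {0..<1} \<omega> \<and> (\<forall>r\<in>{0..<1}. \<omega> r > 0) \<and>
     set_integrable lborel {0..<1::real} \<omega>"

definition wnorm2 :: "(real \<Rightarrow> real) \<Rightarrow> (complex \<Rightarrow> complex) \<Rightarrow> ennreal" where
  "wnorm2 \<omega> f = ennreal ((cmod (f 0))\<^sup>2) +
     ennreal (1 / pi) * (\<integral>\<^sup>+ z. indicator unit_disc z *
        ennreal ((cmod (deriv f z))\<^sup>2 * \<omega> (cmod z)) \<partial>lborel)"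

definition wnorm :: "(real \<Rightarrow> real) \<Rightarrow> (complex \<Rightarrow> complex) \<Rightarrow> ennreal" where
  "wnorm \<omega> f = (if wnorm2 \<omega> f = \<infinity> then \<infinity> else ennreal (sqrt (enn2real (wnorm2 \<omega> f))))"

text \<open>The weighted space \<open>H_\<omega>\<close> (functions are identified with their values on the disc).\<close>
definition Hw :: "(real \<Rightarrow> real) \<Rightarrow> (complex \<Rightarrow> complex) set" where
  "Hw \<omega> = {f. f holomorphic_on unit_disc \<and> wnorm2 \<omega> f < \<infinity>}"

definition op_norm :: "(real \<Rightarrow> real) \<Rightarrow> ((complex \<Rightarrow> complex) \<Rightarrow> (complex \<Rightarrow> complex)) \<Rightarrow> ennreal" where
  "op_norm \<omega> S = (SUP f \<in> {f \<in> Hw \<omega>. wnorm \<omega> f \<le> 1}. wnorm \<omega> (S f))"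

definition rank_less_ops :: "(real \<Rightarrow> real) \<Rightarrow> nat \<Rightarrow> ((complex \<Rightarrow> complex) \<Rightarrow> (complex \<Rightarrow> complex)) set" where
  "rank_less_ops \<omega> n = {R.
     (\<forall>f\<in>Hw \<omega>. R f \<in> Hw \<omega>) \<and>
     (\<forall>f\<in>Hw \<omega>. \<forall>g\<in>Hw \<omega>. \<forall>c a::complex. \<forall>z\<in>unit_disc.
         R (\<lambda>w. c * f w + a * g w) z = c * R f z + a * R g z) \<and>
     n \<ge> 1 \<and>
     (\<exists>gs::nat \<Rightarrow> complex \<Rightarrow> complex. (\<forall>i<n-1. gs i \<in> Hw \<omega>) \<and>
        (\<forall>f\<in>Hw \<omega>. \<exists>c::nat \<Rightarrow> complex. \<forall>z\<in>unit_disc. R f z = (\<Sum>i<n-1. c i * gs i z)))}"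

definition approx_num :: "(real \<Rightarrow> real) \<Rightarrow> ((complex \<Rightarrow> complex) \<Rightarrow> (complex \<Rightarrow> complex)) \<Rightarrow> nat \<Rightarrow> ennreal" where
  "approx_num \<omega> T n = (INF R \<in> rank_less_ops \<omega> n. op_norm \<omega> (\<lambda>f z. T f z - R f z))"

definition comp_op :: "(complex \<Rightarrow> complex) \<Rightarrow> (complex \<Rightarrow> complex) \<Rightarrow> (complex \<Rightarrow> complex)" where
  "comp_op \<phi> f = f \<circ> \<phi>"

definition green :: "complex \<Rightarrow> complex \<Rightarrow> ennreal" where
  "green z w = (if z = w then \<infinity> else ennreal (ln (cmod ((1 - cnj w * z) / (z - w)))))"

definition green_energy :: "complex measure \<Rightarrow> ennreal" where
  "green_energy \<mu> = (\<integral>\<^sup>+ z. (\<integral>\<^sup>+ w. green z w \<partial>\<mu>) \<partial>\<mu>)"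

definition green_V :: "complex set \<Rightarrow> ennreal" where
  "green_V E = (INF \<mu> \<in> {\<mu>. prob_space \<mu> \<and> sets \<mu> = sets borel \<and>
       (\<exists>K. compact K \<and> K \<subseteq> E \<and> emeasure \<mu> K = 1)}. green_energy \<mu>)"

definition green_cap :: "complex set \<Rightarrow> ennreal" where
  "green_cap E = 1 / green_V E"

end

theory Submission
  imports Defs "HOL-Complex_Analysis.Complex_Analysis" "HOL-Real_Asymp.Real_Asymp"
begin

text \<open>
  For distinct points \<open>z\<^sub>1, \<dots>, z\<^sub>N\<close> of a compact subset of \<open>\<phi>(\<bbbD>)\<close> let \<open>B\<^sub>k\<close> be the Blaschke product with
  zeros \<open>z\<^sub>j\<close>, \<open>j \<noteq> k\<close>. An operator of rank less than \<open>N\<close> kills a nontrivial combination \<open>f\<close> of the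
  \<open>B\<^sub>k\<close>; the norm of \<open>f\<close> is at most a constant times \<open>N\<^sup>2 max |c\<^sub>k|\<close>, whereas
  \<open>|f(z\<^sub>k)| = |c\<^sub>k| exp (- \<Sum>\<^sub>j\<^sub>\<noteq>\<^sub>k g(z\<^sub>k, z\<^sub>j))\<close> is controlled by the norm of \<open>f \<circ> \<phi>\<close>, since evaluations at
  points of a compact subset of the disc are bounded. So \<open>a\<^sub>N\<close> is bounded below, up to a factor
  \<open>C N\<^sup>2\<close>, by \<open>exp (- S)\<close> with \<open>S\<close> the largest of the discrete potentials.

  Near-minimisers of the discrete Green energy make all these potentials simultaneously at most
  half of \<open>E\<^sub>N - E\<^sub>N\<^sub>-\<^sub>1\<close> (plus a constant), \<open>E\<^sub>N\<close> being the infimum of the discrete energies. As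
  \<open>E\<^sub>N / (N (N - 1))\<close> increases and is bounded by the energy of any measure on the compact set,
  these increments are at most about \<open>2 N V\<close> for some \<open>N\<close> slightly larger than any given large \<open>n\<close>,
  and \<open>a\<^sub>n \<ge> a\<^sub>N\<close>. No equilibrium measure is needed.
\<close>

section \<open>Area means of holomorphic functions\<close>

text \<open>Both measures give every box the product of its side lengths, and this determines
  Lebesgue measure. The identification carries Tonelli's theorem over from pairs of reals.\<close>

lemma lborel_complex_eq_distr:
  "(lborel :: complex measure) = distr (lborel \<Otimes>\<^sub>M lborel) borel (\<lambda>(x, y). Complex x y)"
proof (rule lborel_eqI)
  have m: "(\<lambda>(x, y). Complex x y) \<in> borel_measurable (lborel \<Otimes>\<^sub>M lborel)"
    unfolding Complex_eq split_def by measurable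
  fix l u :: complex
  assume *: "\<And>b. b \<in> Basis \<Longrightarrow> l \<bullet> b \<le> u \<bullet> b"
  have le: "Re l \<le> Re u" "Im l \<le> Im u"
    using *[of 1] *[of \<i>] by (auto simp: Basis_complex_def)
  have "(\<lambda>(x, y). Complex x y) -` box l u \<inter> space (lborel \<Otimes>\<^sub>M lborel)
      = {Re l<..<Re u} \<times> {Im l<..<Im u}"
    by (auto simp: in_box_complex_iff space_pair_measure)
  then have "emeasure (distr (lborel \<Otimes>\<^sub>M lborel) borel (\<lambda>(x, y). Complex x y)) (box l u)
      = emeasure (lborel \<Otimes>\<^sub>M lborel) ({Re l<..<Re u} \<times> {Im l<..<Im u})"
    using m by (simp add: emeasure_distr)
  also have "\<dots> = ennreal (Re u - Re l) * ennreal (Im u - Im l)"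
    using le by (subst lborel.emeasure_pair_measure_Times) auto
  also have "\<dots> = (\<Prod>b\<in>Basis. (u - l) \<bullet> b)"
    using le by (simp add: Basis_complex_def ennreal_mult'' complex_i_not_one[symmetric])
  finally show "emeasure (distr (lborel \<Otimes>\<^sub>M lborel) borel (\<lambda>(x, y). Complex x y)) (box l u)
      = (\<Prod>b\<in>Basis. (u - l) \<bullet> b)" .
qed simp

lemma measurable_Complex [measurable (raw)]:
  assumes "f \<in> borel_measurable M" "g \<in> borel_measurable M"
  shows "(\<lambda>x. Complex (f x) (g x)) \<in> borel_measurable M"
  using assms unfolding Complex_eq by measurable

lemma nn_integral_complex_iterated:
  assumes [measurable]: "f \<in> borel_measurable borel"
  shows "(\<integral>\<^sup>+z. f z \<partial>lborel) = (\<integral>\<^sup>+y. \<integral>\<^sup>+x. f (Complex x y) \<partial>lborel \<partial>lborel)"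
    and "(\<integral>\<^sup>+z. f z \<partial>lborel) = (\<integral>\<^sup>+x. \<integral>\<^sup>+y. f (Complex x y) \<partial>lborel \<partial>lborel)"
proof -
  have "(\<integral>\<^sup>+z. f z \<partial>lborel) = (\<integral>\<^sup>+p. f (case p of (x, y) \<Rightarrow> Complex x y) \<partial>(lborel \<Otimes>\<^sub>M lborel))"
    by (subst lborel_complex_eq_distr, subst nn_integral_distr) (simp_all add: split_def)
  also have "\<dots> = (\<integral>\<^sup>+x. \<integral>\<^sup>+y. f (Complex x y) \<partial>lborel \<partial>lborel)"
    by (subst lborel.nn_integral_fst[symmetric]) (simp_all add: split_def)
  finally show *: "(\<integral>\<^sup>+z. f z \<partial>lborel) = (\<integral>\<^sup>+x. \<integral>\<^sup>+y. f (Complex x y) \<partial>lborel \<partial>lborel)" .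
  show "(\<integral>\<^sup>+z. f z \<partial>lborel) = (\<integral>\<^sup>+y. \<integral>\<^sup>+x. f (Complex x y) \<partial>lborel \<partial>lborel)"
    unfolding * by (rule lborel_pair.Fubini'[symmetric]) measurable
qed

text \<open>The rotation is split into two affine substitutions in one variable each. For fixed
  \<open>y\<close> the new variable is \<open>X = a * x - b * y\<close>; after exchanging the
  integrals, the ordinate is an affine function of \<open>y\<close> with slope \<open>1 / a\<close>.
  The factor \<open>\<bar>1 / a\<bar>\<close> produced by the first substitution is absorbed by the
  second.\<close>

lemma nn_integral_rotate_Re_nonzero:
  fixes c :: complex
  assumes [measurable]: "f \<in> borel_measurable borel" and c: "cmod c = 1" "Re c \<noteq> 0"
  shows "(\<integral>\<^sup>+z. f (c * z) \<partial>lborel) = (\<integral>\<^sup>+z. f z \<partial>lborel)"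
proof -
  define a b where "a = Re c" and "b = Im c"
  have ab: "a\<^sup>2 + b\<^sup>2 = 1" "a \<noteq> 0"
    using c cmod_power2[of c] by (auto simp: a_def b_def)
  have 1: "(\<integral>\<^sup>+x. f (c * Complex x y) \<partial>lborel) =
        ennreal \<bar>1 / a\<bar> * (\<integral>\<^sup>+X. f (Complex X (X * b / a + y / a)) \<partial>lborel)" for y
  proof -
    have "(\<integral>\<^sup>+x. f (c * Complex x y) \<partial>lborel) =
        ennreal \<bar>1 / a\<bar> * (\<integral>\<^sup>+X. f (c * Complex (b * y / a + 1 / a * X) y) \<partial>lborel)"
      by (rule nn_integral_real_affine) (use ab in auto)
    moreover have "c * Complex (b * y / a + 1 / a * X) y = Complex X (X * b / a + y / a)" for X
    proof (rule complex_eqI)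
      have "b * (b * y / a + 1 / a * X) + a * y = (a\<^sup>2 + b\<^sup>2) * y / a + X * b / a"
        using ab(2) by (simp add: field_simps power2_eq_square)
      then show "Im (c * Complex (b * y / a + 1 / a * X) y) = Im (Complex X (X * b / a + y / a))"
        unfolding ab(1) by (simp add: a_def b_def algebra_simps)
    qed (use ab(2) in \<open>simp add: a_def b_def field_simps\<close>)
    ultimately show ?thesis by simp
  qed
  have "(\<integral>\<^sup>+z. f (c * z) \<partial>lborel) = (\<integral>\<^sup>+y. \<integral>\<^sup>+x. f (c * Complex x y) \<partial>lborel \<partial>lborel)"
    by (rule nn_integral_complex_iterated) measurable
  also have "\<dots> = ennreal \<bar>1 / a\<bar> *
      (\<integral>\<^sup>+y. \<integral>\<^sup>+x. f (Complex x (x * b / a + y / a)) \<partial>lborel \<partial>lborel)"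
    unfolding 1 by (rule nn_integral_cmult) measurable
  also have "(\<integral>\<^sup>+y. \<integral>\<^sup>+x. f (Complex x (x * b / a + y / a)) \<partial>lborel \<partial>lborel) =
      (\<integral>\<^sup>+x. \<integral>\<^sup>+y. f (Complex x (x * b / a + y / a)) \<partial>lborel \<partial>lborel)"
    by (rule lborel_pair.Fubini') measurable
  also have "ennreal \<bar>1 / a\<bar> * \<dots> =
      (\<integral>\<^sup>+x. ennreal \<bar>1 / a\<bar> * (\<integral>\<^sup>+y. f (Complex x (x * b / a + 1 / a * y)) \<partial>lborel) \<partial>lborel)"
    by (subst nn_integral_cmult) auto
  also have "\<dots> = (\<integral>\<^sup>+x. \<integral>\<^sup>+y. f (Complex x y) \<partial>lborel \<partial>lborel)"
    by (intro nn_integral_cong nn_integral_real_affine[symmetric]) (use ab in auto)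
  also have "\<dots> = (\<integral>\<^sup>+z. f z \<partial>lborel)"
    by (rule nn_integral_complex_iterated(2)[symmetric]) measurable
  finally show ?thesis .
qed

lemma nn_integral_rotate:
  fixes c :: complex
  assumes [measurable]: "f \<in> borel_measurable borel" and c: "cmod c = 1"
  shows "(\<integral>\<^sup>+z. f (c * z) \<partial>lborel) = (\<integral>\<^sup>+z. f z \<partial>lborel)"
proof (cases "Re c = 0")
  case True
  \<comment> \<open>A quarter turn is performed as two rotations by its square root, whose real part
    does not vanish.\<close>
  define d where "d = csqrt c"
  have d: "c = d * d"
    using power2_csqrt[of c] by (simp add: d_def power2_eq_square)
  have "cmod d = 1"
    using c unfolding d_def by (simp add: norm_csqrt)
  moreover have "Re d \<noteq> 0"
  proof
    assume "Re d = 0"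
    then have "Im d * Im d = 0" "Im c = 0" using True d by (auto simp: complex_eq_iff)
    then show False using c True by (simp add: cmod_def)
  qed
  ultimately show ?thesis
    using nn_integral_rotate_Re_nonzero[of "\<lambda>z. f (d * z)" d] nn_integral_rotate_Re_nonzero[of f d]
    by (simp add: d mult.assoc)
qed (use nn_integral_rotate_Re_nonzero[OF assms] in auto)

text \<open>The image of area on the disc under \<open>cmod\<close> and the measure with density
  \<open>2 * pi * x\<close> on \<open>{0..1}\<close> have the same distribution function, namely
  \<open>pi * x^2\<close> on the unit interval, so they coincide.\<close>

lemma nn_integral_radial:
  assumes [measurable]: "f \<in> borel_measurable borel"
  shows "(\<integral>\<^sup>+z. indicator unit_disc z * f (cmod z) \<partial>lborel)
       = (\<integral>\<^sup>+x. ennreal (2 * pi * x) * indicator {0..1} x * f x \<partial>lborel)"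
proof -
  define M1 where "M1 = distr (density lborel (indicator unit_disc)) borel cmod"
  define M2 where "M2 = density lborel (\<lambda>x::real. ennreal (2 * pi * x) * indicator {0..1} x)"
  have e1: "emeasure M1 {..x} = (if x < 0 then 0 else if x < 1 then ennreal (pi * x\<^sup>2) else ennreal pi)" for x
  proof -
    have "emeasure M1 {..x} = emeasure (density lborel (indicator unit_disc)) (cmod -` {..x})"
      unfolding M1_def by (subst emeasure_distr) auto
    also have "\<dots> = emeasure lborel (unit_disc \<inter> cmod -` {..x})"
    proof -
      have [measurable]: "cmod -` {..x} \<in> sets borel"
        by (intro borel_closed continuous_closed_vimage) (auto intro: continuous_intros)
      show ?thesis
        by (subst emeasure_density) (auto simp: indicator_inter_arith[symmetric] intro: borel_measurable_indicator)
    qed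
    also have "\<dots> = (if x < 0 then 0 else if x < 1 then ennreal (pi * x\<^sup>2) else ennreal pi)"
    proof -
      have "unit_disc \<inter> cmod -` {..x} = {}" if "x < 0"
        using that by (auto) (meson norm_ge_zero order_trans not_le)
      moreover have "unit_disc \<inter> cmod -` {..x} = cball 0 x" if "x < 1"
        using that by auto
      moreover have "unit_disc \<inter> cmod -` {..x} = unit_disc" if "x \<ge> 1"
        using that by auto
      ultimately show ?thesis
        by (auto simp: emeasure_cball emeasure_ball unit_ball_vol_2)
    qed
    finally show ?thesis .
  qed
  have e2: "emeasure M2 {..x} = (if x < 0 then 0 else if x < 1 then ennreal (pi * x\<^sup>2) else ennreal pi)" for x
  proof -
    have "emeasure M2 {..x} = (\<integral>\<^sup>+y. ennreal (2 * pi * y) * indicator {0..min x 1} y \<partial>lborel)"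
      unfolding M2_def by (subst emeasure_density) (auto intro!: nn_integral_cong split: split_indicator)
    also have "\<dots> = (if x < 0 then 0 else ennreal (pi * (min x 1)\<^sup>2 - pi * 0\<^sup>2))"
    proof (cases "x < 0")
      case False
      have "(\<integral>\<^sup>+y. ennreal (2 * pi * y) * indicator {0..min x 1} y \<partial>lborel) =
         ennreal (pi * (min x 1)\<^sup>2 - pi * 0\<^sup>2)"
        by (rule nn_integral_FTC_Icc) (use False in \<open>auto intro!: derivative_eq_intros\<close>)
      then show ?thesis using False by simp
    qed simp
    finally show ?thesis by (auto simp: min_def)
  qed
  have "M1 = M2"
  proof (rule cdf_unique')
    have "finite_measure M1"
    proof (rule finite_measureI)
      have "emeasure M1 (space M1) = emeasure lborel unit_disc"
        unfolding M1_def by (subst emeasure_distr) (auto simp: emeasure_density borel_measurable_indicator)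
      then show "emeasure M1 (space M1) \<noteq> \<infinity>"
        by (simp add: emeasure_ball)
    qed
    then show "finite_borel_measure M1"
      by (simp add: finite_borel_measure_def finite_borel_measure_axioms_def M1_def)
    have "finite_measure M2"
    proof (rule finite_measureI)
      have "emeasure M2 (space M2) = emeasure M2 {..1}"
        unfolding M2_def by (subst (1 2) emeasure_density) (auto intro!: nn_integral_cong split: split_indicator)
      then show "emeasure M2 (space M2) \<noteq> \<infinity>"
        by (simp add: e2)
    qed
    then show "finite_borel_measure M2"
      by (simp add: finite_borel_measure_def finite_borel_measure_axioms_def M2_def)
    show "cdf M1 = cdf M2"
      by (rule ext) (simp add: cdf_def measure_def e1 e2)
  qed
  have "(\<integral>\<^sup>+z. indicator unit_disc z * f (cmod z) \<partial>lborel) = (\<integral>\<^sup>+x. f x \<partial>M1)"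
    unfolding M1_def
    by (subst nn_integral_distr, simp, simp, subst nn_integral_density)
      (auto intro: borel_measurable_indicator)
  also have "\<dots> = (\<integral>\<^sup>+x. f x \<partial>M2)"
    by (simp add: \<open>M1 = M2\<close>)
  also have "\<dots> = (\<integral>\<^sup>+x. ennreal (2 * pi * x) * indicator {0..1} x * f x \<partial>lborel)"
    unfolding M2_def by (simp add: nn_integral_density)
  finally show ?thesis .
qed

section \<open>Mean value inequalities on circles and discs\<close>

text \<open>Cauchy's formula on the unit circle for \<open>s \<mapsto> u (s * z)\<close>, evaluated
  at \<open>s = 0\<close>. The circle is parametrised by rotations of \<open>z\<close>, so that
  rotation invariance of area can be applied afterwards.\<close>

lemma circle_mean_bound:
  fixes u :: "complex \<Rightarrow> complex"
  assumes u: "u holomorphic_on ball 0 r" and z: "cmod z < r"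
  shows "ennreal (cmod (u 0)) \<le>
    (\<integral>\<^sup>+t. indicator {0..1} t * ennreal (cmod (u (exp (2 * pi * t * \<i>) * z))) \<partial>lborel)"
proof -
  define v where "v s = u (s * z)" for s
  have "v holomorphic_on cball 0 1"
  proof -
    have "(\<lambda>s. s * z) ` cball 0 1 \<subseteq> ball 0 r"
      using z by (auto simp: norm_mult) (meson mult_left_le_one_le norm_ge_zero order_le_less_trans)
    then have "u \<circ> (\<lambda>s. s * z) holomorphic_on cball 0 1"
      by (intro holomorphic_on_compose holomorphic_intros holomorphic_on_subset[OF u])
    then show ?thesis by (simp add: v_def[abs_def] o_def)
  qed
  then have v: "((\<lambda>s. v s / (s - 0)) has_contour_integral (2 * of_real pi * \<i> * v 0)) (circlepath 0 1)"
    by (intro Cauchy_integral_circlepath_simple) auto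
  have cv: "continuous_on {0..1} (\<lambda>t. v (exp (2 * pi * t * \<i>)))"
    by (rule continuous_on_compose2[OF holomorphic_on_imp_continuous_on[OF \<open>v holomorphic_on _\<close>]])
      (auto intro!: continuous_intros simp: norm_exp_eq_Re)
  have "((\<lambda>t. 2 * of_real pi * \<i> * v (exp (2 * pi * t * \<i>))) has_integral (2 * of_real pi * \<i> * v 0)) {0..1}"
    using v unfolding has_contour_integral
    by (rule has_integral_eq[rotated])
      (simp add: vector_derivative_circlepath, simp add: circlepath mult_ac)
  from has_integral_mult_right[OF this, of "1 / (2 * of_real pi * \<i>)"]
  have I: "((\<lambda>t. v (exp (2 * pi * t * \<i>))) has_integral v 0) {0..1}"
    by simp
  have "cmod (v 0) \<le> integral {0..1} (\<lambda>t. cmod (v (exp (2 * pi * t * \<i>))))"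
    unfolding integral_unique[OF I, symmetric]
    by (intro integral_norm_bound_integral integrable_continuous_interval continuous_intros cv) auto
  moreover have "((\<lambda>t. cmod (v (exp (2 * pi * t * \<i>)))) has_integral
      integral {0..1} (\<lambda>t. cmod (v (exp (2 * pi * t * \<i>))))) {0..1}"
    by (intro integrable_integral integrable_continuous_interval continuous_intros cv)
  from nn_integral_has_integral_lebesgue'[OF _ this]
  have "(\<integral>\<^sup>+t. ennreal (cmod (v (exp (2 * pi * t * \<i>)))) * indicator {0..1} t \<partial>lborel) =
     ennreal (integral {0..1} (\<lambda>t. cmod (v (exp (2 * pi * t * \<i>)))))"
    by simp
  ultimately show ?thesis
    by (simp add: v_def mult.commute ennreal_leI)
qed

text \<open>Integrate the circle inequality over all starting points \<open>z\<close> of the disc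
  and exchange the two integrals. By rotation invariance the inner area integral is the same for
  every angle \<open>t\<close>, so the average over \<open>t\<close> disappears.\<close>

lemma area_mean_bound:
  fixes u :: "complex \<Rightarrow> complex"
  assumes u: "u holomorphic_on ball \<zeta> r" and r: "r > 0"
  shows "ennreal (pi * r\<^sup>2 * cmod (u \<zeta>)) \<le> (\<integral>\<^sup>+z. indicator (ball \<zeta> r) z * ennreal (cmod (u z)) \<partial>lborel)"
proof -
  define v where "v z = u (z + \<zeta>)" for z
  have v: "v holomorphic_on ball 0 r"
  proof -
    have "u \<circ> (\<lambda>z. z + \<zeta>) holomorphic_on ball 0 r"
      by (intro holomorphic_on_compose holomorphic_intros holomorphic_on_subset[OF u]) (auto simp: dist_norm)
    then show ?thesis by (simp add: v_def[abs_def] o_def)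
  qed
  define F where "F z = indicator (ball 0 r) z * ennreal (cmod (v z))" for z
  have F[measurable]: "F \<in> borel_measurable borel"
  proof -
    have "(\<lambda>z. indicator (ball 0 r) z *\<^sub>R cmod (v z)) \<in> borel_measurable borel"
      by (intro borel_measurable_continuous_on_indicator continuous_intros
          holomorphic_on_imp_continuous_on v) auto
    from measurable_compose[OF this measurable_ennreal]
    have "(\<lambda>z. ennreal (indicator (ball 0 r) z *\<^sub>R cmod (v z))) \<in> borel_measurable borel" .
    moreover have "(\<lambda>z. ennreal (indicator (ball 0 r) z *\<^sub>R cmod (v z))) = F"
      by (auto simp: F_def fun_eq_iff split: split_indicator)
    ultimately show ?thesis by (simp only:)
  qed
  have em[measurable]: "(\<lambda>t. exp (2 * pi * t * \<i>)) \<in> borel_measurable borel"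
    by (intro borel_measurable_continuous_onI continuous_intros)
  have "ennreal (pi * r\<^sup>2 * cmod (u \<zeta>)) = (\<integral>\<^sup>+z. indicator (ball (0::complex) r) z * ennreal (cmod (v 0)) \<partial>lborel)"
    using r by (subst nn_integral_multc)
      (auto simp: emeasure_ball unit_ball_vol_2 ennreal_mult v_def intro: borel_measurable_indicator)
  also have "\<dots> \<le> (\<integral>\<^sup>+z. \<integral>\<^sup>+t. indicator {0..1} t * F (exp (2 * pi * t * \<i>) * z) \<partial>lborel \<partial>lborel)"
  proof (rule nn_integral_mono)
    fix z :: complex
    show "indicator (ball 0 r) z * ennreal (cmod (v 0))
        \<le> (\<integral>\<^sup>+t. indicator {0..1} t * F (exp (2 * pi * t * \<i>) * z) \<partial>lborel)"
    proof (cases "z \<in> ball 0 r")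
      case True
      then show ?thesis
        using circle_mean_bound[OF v, of z] by (simp add: F_def norm_mult norm_exp_eq_Re)
    qed simp
  qed
  also have "\<dots> = (\<integral>\<^sup>+t. \<integral>\<^sup>+z. indicator {0..1} t * F (exp (2 * pi * t * \<i>) * z) \<partial>lborel \<partial>lborel)"
    by (rule lborel_pair.Fubini') measurable
  also have "\<dots> = (\<integral>\<^sup>+t. indicator {0..1} t * (\<integral>\<^sup>+z. F z \<partial>lborel) \<partial>(lborel::real measure))"
    by (intro nn_integral_cong, subst nn_integral_cmult) (auto simp: nn_integral_rotate norm_exp_eq_Re)
  also have "\<dots> = (\<integral>\<^sup>+z. F z \<partial>lborel)"
    by (simp add: nn_integral_multc)
  also have "\<dots> = (\<integral>\<^sup>+z. F z \<partial>distr lborel borel ((+) (-\<zeta>)))"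
    by (simp add: lborel_distr_plus)
  also have "\<dots> = (\<integral>\<^sup>+z. F (-\<zeta> + z) \<partial>lborel)"
    by (rule nn_integral_distr) measurable
  also have "\<dots> = (\<integral>\<^sup>+z. indicator (ball \<zeta> r) z * ennreal (cmod (u z)) \<partial>lborel)"
    by (intro nn_integral_cong) (auto simp: F_def v_def dist_norm norm_minus_commute split: split_indicator)
  finally show ?thesis .
qed

section \<open>Discrete Green energy\<close>

text \<open>Ordered pairs are summed, so each pair of points counts twice; the factors 2 in the
  recursions below come from this.\<close>

definition disc_energy :: "complex set \<Rightarrow> ennreal" where
  "disc_energy Z = (\<Sum>z\<in>Z. \<Sum>w\<in>Z - {z}. green z w)"

text \<open>The Fekete energy for the Green kernel, before division by \<open>N * (N - 1)\<close>.
  Points are collected in sets, so they are distinct and the infinite diagonal of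
  \<open>green\<close> never enters; if \<open>K\<close> has fewer than \<open>N\<close> points the
  value is \<open>top\<close>.\<close>

definition min_energy :: "complex set \<Rightarrow> nat \<Rightarrow> ennreal" where
  "min_energy K N = (INF Z \<in> {Z. finite Z \<and> Z \<subseteq> K \<and> card Z = N}. disc_energy Z)"

lemma green_commute: "green z w = green w z"
proof -
  have "cmod (1 - cnj w * z) = cmod (1 - cnj z * w)"
    using complex_mod_cnj[of "1 - cnj w * z"] by (simp add: mult.commute)
  then show ?thesis
    by (auto simp: green_def norm_divide norm_minus_commute)
qed

lemma green_measurable [measurable (raw)]:
  assumes [measurable]: "f \<in> borel_measurable M" "g \<in> borel_measurable M"
  shows "(\<lambda>x. green (f x) (g x)) \<in> borel_measurable M"
proof -
  have [measurable]: "cnj \<in> borel_measurable borel"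
    by (intro borel_measurable_continuous_onI continuous_intros)
  show ?thesis
    unfolding green_def by measurable
qed

lemma disc_energy_insert:
  assumes "finite Z" "w \<notin> Z"
  shows "disc_energy (insert w Z) = disc_energy Z + 2 * (\<Sum>z\<in>Z. green z w)"
proof -
  have "(\<Sum>v\<in>insert w Z - {z}. green z v) = green z w + (\<Sum>v\<in>Z - {z}. green z v)" if "z \<in> Z" for z
  proof -
    have "insert w Z - {z} = insert w (Z - {z})" using that assms by auto
    then show ?thesis using assms by simp
  qed
  then have "disc_energy (insert w Z) =
      (\<Sum>v\<in>Z. green w v) + (\<Sum>z\<in>Z. green z w + (\<Sum>v\<in>Z - {z}. green z v))"
    using assms by (simp add: disc_energy_def)
  also have "(\<Sum>v\<in>Z. green w v) = (\<Sum>z\<in>Z. green z w)"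
    by (simp add: green_commute)
  finally show ?thesis
    by (simp add: disc_energy_def sum.distrib mult_2 add_ac)
qed

lemma disc_energy_remove:
  assumes "finite Z" "k \<in> Z"
  shows "disc_energy Z = disc_energy (Z - {k}) + 2 * (\<Sum>z\<in>Z - {k}. green k z)"
  using disc_energy_insert[of "Z - {k}" k] assms by (simp add: insert_absorb green_commute)

text \<open>The averaging principle behind the choice of points: \<open>K\<close> carries all the
  mass, so integrating the constant infimum over \<open>K\<close> returns it unchanged.\<close>

lemma INF_le_nn_integral:
  assumes "prob_space M" "K \<in> sets M" "emeasure M K = 1"
  shows "(INF z\<in>K. F z) \<le> (\<integral>\<^sup>+z. F z \<partial>M)"
proof -
  have "(INF z\<in>K. F z) = (\<integral>\<^sup>+z. (INF z\<in>K. F z) * indicator K z \<partial>M)"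
    using assms by (simp add: nn_integral_cmult_indicator)
  also have "\<dots> \<le> (\<integral>\<^sup>+z. F z \<partial>M)"
    by (intro nn_integral_mono) (auto split: split_indicator intro: INF_lower)
  finally show ?thesis .
qed

text \<open>The extra potential \<open>h\<close> absorbs the interaction with the points already chosen, so that
  averaging over one point at a time replaces integration over a product space.\<close>
lemma min_energy_potential_le:
  fixes h :: "complex \<Rightarrow> ennreal"
  assumes M: "prob_space M" "sets M = sets borel" "K \<in> sets borel" "emeasure M K = 1"
    and [measurable]: "h \<in> borel_measurable borel"
  shows "(INF Z \<in> {Z. finite Z \<and> Z \<subseteq> K \<and> card Z = N}. disc_energy Z + (\<Sum>z\<in>Z. h z))
    \<le> of_nat (N * (N - 1)) * green_energy M + of_nat N * (\<integral>\<^sup>+z. h z \<partial>M)"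
  using assms(5)
proof (induction N arbitrary: h)
  case 0
  have "(INF Z \<in> {Z. finite Z \<and> Z \<subseteq> K \<and> card Z = 0}. disc_energy Z + (\<Sum>z\<in>Z. h z))
      \<le> disc_energy {} + (\<Sum>z\<in>{}. h z)"
    by (intro INF_lower) auto
  then show ?case by (simp add: disc_energy_def)
next
  case (Suc N)
  interpret prob_space M by fact
  note [measurable_cong] = M(2)
  note [measurable] = Suc.prems
  let ?I = "green_energy M" and ?H = "\<integral>\<^sup>+z. h z \<partial>M"
  let ?L = "INF Z \<in> {Z. finite Z \<and> Z \<subseteq> K \<and> card Z = Suc N}. disc_energy Z + (\<Sum>z\<in>Z. h z)"
  have step: "?L \<le> h w + (of_nat (N * (N - 1)) * ?I + of_nat N * (?H + 2 * (\<integral>\<^sup>+z. green w z \<partial>M)))"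
    if "w \<in> K" for w
  proof (cases "h w = top")
    case hw: False
    let ?h = "\<lambda>z. h z + 2 * green z w"
    \<comment> \<open>The term \<open>h w\<close> is moved to the left, which is legitimate because
      it is finite here, so that the remaining infimum is exactly that of the induction hypothesis
      for the potential \<open>?h\<close>.\<close>
    have "?L - h w \<le> (INF Z \<in> {Z. finite Z \<and> Z \<subseteq> K \<and> card Z = N}. disc_energy Z + (\<Sum>z\<in>Z. ?h z))"
    proof (rule INF_greatest)
      fix Z assume Z: "Z \<in> {Z. finite Z \<and> Z \<subseteq> K \<and> card Z = N}"
      show "?L - h w \<le> disc_energy Z + (\<Sum>z\<in>Z. ?h z)"
      proof (cases "w \<in> Z")
        \<comment> \<open>A set that already contains \<open>w\<close> is no competitor:
          \<open>green w w\<close> is infinite and makes the right-hand side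
          \<open>top\<close>.\<close>
        case True
        then have "?h w \<le> (\<Sum>z\<in>Z. ?h z)"
          using Z by (intro member_le_sum) auto
        then have "(\<Sum>z\<in>Z. ?h z) = top"
          by (simp add: green_def ennreal_mult_top top_unique)
        then show ?thesis by simp
      next
        case False
        then have "?L \<le> disc_energy (insert w Z) + (\<Sum>z\<in>insert w Z. h z)"
          using Z that by (intro INF_lower) auto
        also have "\<dots> = h w + (disc_energy Z + (\<Sum>z\<in>Z. ?h z))"
          using False Z by (simp add: disc_energy_insert sum.distrib sum_distrib_left add_ac)
        finally show ?thesis
          using hw by (simp add: ennreal_minus_le_iff)
      qed
    qed
    also have "\<dots> \<le> of_nat (N * (N - 1)) * ?I + of_nat N * (\<integral>\<^sup>+z. ?h z \<partial>M)"
      by (rule Suc.IH) measurable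
    also have "(\<integral>\<^sup>+z. ?h z \<partial>M) = ?H + 2 * (\<integral>\<^sup>+z. green w z \<partial>M)"
      by (simp add: nn_integral_add nn_integral_cmult green_commute[of w])
    finally show ?thesis
      by (simp add: ennreal_minus_le_iff)
  qed simp
  have "?L = (INF w\<in>K. ?L)"
    using M(4) by (cases "K = {}") auto
  also have "\<dots> \<le> (INF w\<in>K. h w + (of_nat (N * (N - 1)) * ?I + of_nat N * (?H + 2 * (\<integral>\<^sup>+z. green w z \<partial>M))))"
    by (intro INF_mono) (use step in auto)
  also have "\<dots> \<le> (\<integral>\<^sup>+w. h w + (of_nat (N * (N - 1)) * ?I + of_nat N * (?H + 2 * (\<integral>\<^sup>+z. green w z \<partial>M))) \<partial>M)"
    by (rule INF_le_nn_integral) (use M in auto)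
  \<comment> \<open>Averaging the potential of \<open>M\<close> at \<open>w\<close> over
    \<open>w\<close> gives the energy of \<open>M\<close> once more, and
    \<open>N * (N - 1) + 2 * N\<close> is the number of ordered pairs among \<open>N + 1\<close>
    points.\<close>
  also have "\<dots> = ?H + (of_nat (N * (N - 1)) * ?I + of_nat N * (?H + 2 * ?I))"
    by (simp add: nn_integral_add nn_integral_cmult emeasure_space_1 green_energy_def)
  also have "\<dots> = of_nat (Suc N * (Suc N - 1)) * ?I + of_nat (Suc N) * ?H"
  proof -
    have "Suc N * (Suc N - 1) = N * (N - 1) + 2 * N"
      by (cases N) auto
    then show ?thesis by (simp only: of_nat_add of_nat_mult of_nat_Suc) (simp add: algebra_simps)
  qed
  finally show ?case .
qed

section \<open>Growth of the minimal energies\<close>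

text \<open>The right-hand side is the mean energy of \<open>N\<close> independent points
  distributed according to \<open>M\<close>.\<close>

lemma min_energy_le:
  assumes "prob_space M" "sets M = sets borel" "K \<in> sets borel" "emeasure M K = 1"
  shows "min_energy K N \<le> of_nat (N * (N - 1)) * green_energy M"
  using min_energy_potential_le[OF assms, of "\<lambda>_. 0" N] by (simp add: min_energy_def)

lemma min_energy_lower:
  "finite Z \<Longrightarrow> Z \<subseteq> K \<Longrightarrow> min_energy K (card Z) \<le> disc_energy Z"
  unfolding min_energy_def by (rule INF_lower) auto

text \<open>When the points of an \<open>(N + 1)\<close>-set are deleted one at a time, every pair
  survives \<open>N - 1\<close> of the deletions. The inequality is the cross-multiplied form of the
  monotonicity of \<open>min_energy K N / (N * (N - 1))\<close>.\<close>

lemma min_energy_Suc: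
  assumes "N \<ge> 2"
  shows "of_nat (Suc N) * min_energy K N \<le> of_nat (N - 1) * min_energy K (Suc N)"
proof -
  have N: "of_nat (N - 1) \<noteq> (0::ennreal)" "of_nat (N - 1) \<noteq> (top::ennreal)"
    using assms by auto
  have le: "of_nat (Suc N) * min_energy K N \<le> of_nat (N - 1) * disc_energy Z"
    if Z: "finite Z" "Z \<subseteq> K" "card Z = Suc N" for Z
  proof (cases "disc_energy Z = top")
    case True
    then show ?thesis using N by (simp add: ennreal_mult_top)
  next
    case False
    \<comment> \<open>Adding \<open>2 * disc_energy Z\<close> on both sides avoids subtraction in
      \<open>ennreal\<close>: it restores to each deleted set the interactions of the deleted point.
      It is cancelled at the end, where finiteness is used.\<close>
    have "2 * disc_energy Z + of_nat (Suc N) * min_energy K N =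
        2 * disc_energy Z + (\<Sum>k\<in>Z. min_energy K N)"
      using Z by simp
    also have "\<dots> \<le> 2 * disc_energy Z + (\<Sum>k\<in>Z. disc_energy (Z - {k}))"
    proof (intro add_mono sum_mono)
      fix k assume "k \<in> Z"
      then show "min_energy K N \<le> disc_energy (Z - {k})"
        using min_energy_lower[of "Z - {k}" K] Z by auto
    qed simp
    also have "\<dots> = (\<Sum>k\<in>Z. disc_energy (Z - {k}) + 2 * (\<Sum>z\<in>Z - {k}. green k z))"
      by (simp add: sum.distrib disc_energy_def[of Z] sum_distrib_left add.commute)
    also have "\<dots> = (\<Sum>k\<in>Z. disc_energy Z)"
      by (intro sum.cong refl disc_energy_remove[symmetric] Z)
    also have "\<dots> = of_nat (2 + (N - 1)) * disc_energy Z"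
      using Z assms by simp
    also have "\<dots> = 2 * disc_energy Z + of_nat (N - 1) * disc_energy Z"
      by (simp only: of_nat_add distrib_right of_nat_numeral)
    finally show ?thesis
      using False by (simp add: ennreal_add_left_cancel_le ennreal_mult_eq_top_iff)
  qed
  have "of_nat (Suc N) * min_energy K N / of_nat (N - 1) \<le> min_energy K (Suc N)"
    unfolding min_energy_def[of K "Suc N"]
    by (intro INF_greatest divide_le_posI_ennreal) (use le N in \<open>auto simp: zero_less_iff_neq_zero\<close>)
  then have "of_nat (N - 1) * (of_nat (Suc N) * min_energy K N / of_nat (N - 1)) \<le>
      of_nat (N - 1) * min_energy K (Suc N)"
    by (rule mult_left_mono) simp
  then show ?thesis
    using N by (simp only: ennreal_times_divide mult.commute[of "of_nat (N - 1)" "of_nat (Suc N) * min_energy K N"]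
        mult_divide_eq_ennreal[OF N])
qed

text \<open>Deleting one point from a near-minimiser leaves a competitor for one point less, so every
  point of it carries at most half the increment of the minimal energies.\<close>
lemma near_minimiser_potential:
  assumes fin: "min_energy K (Suc N) < top"
  obtains Z where "finite Z" "Z \<subseteq> K" "card Z = Suc N"
    "\<forall>k\<in>Z. min_energy K N + 2 * (\<Sum>z\<in>Z - {k}. green k z) \<le> min_energy K (Suc N) + 1"
proof -
  \<comment> \<open>The slack 1 is harmless: it changes the potentials by a bounded amount, which
    disappears after taking \<open>n\<close>-th roots.\<close>
  have "min_energy K (Suc N) < min_energy K (Suc N) + 1"
    using fin by (cases "min_energy K (Suc N)") (auto simp flip: ennreal_1 ennreal_plus simp: ennreal_less_iff)
  then obtain Z where Z: "finite Z" "Z \<subseteq> K" "card Z = Suc N" "disc_energy Z < min_energy K (Suc N) + 1"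
    unfolding min_energy_def[of K "Suc N"] INF_less_iff by auto
  have "min_energy K N + 2 * (\<Sum>z\<in>Z - {k}. green k z) \<le> min_energy K (Suc N) + 1" if "k \<in> Z" for k
  proof -
    have "min_energy K N + 2 * (\<Sum>z\<in>Z - {k}. green k z) \<le> disc_energy Z"
      unfolding disc_energy_remove[OF Z(1) that]
      using min_energy_lower[of "Z - {k}" K] Z that by (intro add_mono) auto
    with Z(4) show ?thesis by simp
  qed
  with Z(1-3) that show thesis by blast
qed

text \<open>The normalised energies \<open>e N / (N (N - 1))\<close> increase to a finite limit, so their increments
  cannot all exceed \<open>\<delta> / N\<close> on a window \<open>(n, (1 + \<delta>) n]\<close> with \<open>n\<close> large.\<close>
lemma small_increment_in_window:
  fixes e :: "nat \<Rightarrow> real"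
  assumes mono: "\<And>N. N \<ge> 2 \<Longrightarrow> real (Suc N) * e N \<le> real (N - 1) * e (Suc N)"
    and bound: "\<And>N. e N \<le> real (N * (N - 1)) * V" and V_nonneg: "V \<ge> 0"
    and \<delta>: "0 < \<delta>" "\<delta> \<le> 1"
  shows "\<forall>\<^sub>F n in sequentially. \<exists>N\<ge>n. real (Suc N) \<le> (1 + 2 * \<delta>) * real n \<and>
           (e (Suc N) - e N) / 2 \<le> real (Suc N) * (V + \<delta>)"
proof -
  define v where "v N = e N / (real N * (real N - 1))" for N
  have v_le: "v N \<le> V" if "N \<ge> 2" for N
    using bound[of N] that by (simp add: v_def field_simps of_nat_diff)
  have v_mono: "v N \<le> v (Suc N)" if "N \<ge> 2" for N
  proof -
    have "v N = (real (Suc N) * e N) / (real (Suc N) * real N * (real N - 1))"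
      using that by (simp add: v_def)
    also have "\<dots> \<le> (real (N - 1) * e (Suc N)) / (real (Suc N) * real N * (real N - 1))"
      using mono[OF that] that by (intro divide_right_mono) auto
    also have "\<dots> = v (Suc N)"
      using that by (simp add: v_def of_nat_diff)
    finally show ?thesis .
  qed
  have inc: "incseq (\<lambda>n. v (n + 2))"
    by (rule incseq_SucI) (use v_mono in auto)
  then obtain L where L: "(\<lambda>n. v (n + 2)) \<longlonglongrightarrow> L"
    by (rule incseq_convergent[of _ V]) (use v_le in auto)
  then have L: "v \<longlonglongrightarrow> L"
    by (rule LIMSEQ_offset)
  have vL: "v N \<le> L" if "N \<ge> 2" for N
    using incseq_le[OF inc LIMSEQ_ignore_initial_segment[OF L, of 2], of "N - 2"] that by (simp del: add_2_eq_Suc')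
  \<comment> \<open>The threshold is matched to the window: at least \<open>\<delta> * n\<close>
    steps, each larger than \<open>\<delta> / (2 * n)\<close>, would add up to
    \<open>\<delta>^2 / 2\<close>, more than \<open>v\<close> can still grow.\<close>
  have "\<forall>\<^sub>F n in sequentially. v n > L - \<delta>\<^sup>2 / 2"
    using \<delta> by (intro order_tendstoD(1)[OF L]) auto
  moreover have "\<forall>\<^sub>F n in sequentially. n \<ge> nat \<lceil>1 / \<delta>\<rceil> + 2"
    by (rule eventually_ge_at_top)
  ultimately show ?thesis
  proof eventually_elim
    case (elim n)
    \<comment> \<open>The number of steps in the window. Since \<open>\<delta> * n \<ge> 1\<close>,
      rounding up keeps it below \<open>2 * \<delta> * n\<close>, and \<open>d \<le> n\<close> gives
      \<open>Suc N \<le> 2 * n\<close> throughout.\<close>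
    define d where "d = nat \<lceil>\<delta> * n\<rceil>"
    have n: "n \<ge> 2" "\<delta> * n \<ge> 1"
    proof -
      have "1 / \<delta> \<le> real n" using elim by linarith
      then show "\<delta> * n \<ge> 1" using \<delta> by (simp add: field_simps)
    qed (use elim in auto)
    have d: "\<delta> * n \<le> d" "real d \<le> \<delta> * n + 1" "real d \<le> real n"
    proof -
      show "\<delta> * n \<le> d" "real d \<le> \<delta> * n + 1" using n unfolding d_def by linarith+
      have "\<delta> * n \<le> n" using \<delta> by (simp add: mult_left_le_one_le)
      then have "\<lceil>\<delta> * n\<rceil> \<le> int n" by (simp add: ceiling_le_iff)
      then show "real d \<le> real n" using n unfolding d_def by linarith
    qed
    have "\<exists>N\<in>{n..<n+d}. real (Suc N) * (v (Suc N) - v N) \<le> \<delta>"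
    proof (rule ccontr)
      assume neg: "\<not> ?thesis"
      have *: "\<delta> / real (2 * n) \<le> v (Suc N) - v N" if "N \<in> {n..<n+d}" for N
      proof -
        have "\<delta> < real (Suc N) * (v (Suc N) - v N)"
          using neg that by (auto simp: not_le)
        also have "\<dots> \<le> real (2 * n) * (v (Suc N) - v N)"
          using that d n v_mono[of N] by (intro mult_right_mono) auto
        finally show ?thesis using n by (simp add: field_simps)
      qed
      have "\<delta>\<^sup>2 / 2 \<le> real d * (\<delta> / real (2 * n))"
        using d(1) n(1) \<delta> by (simp add: field_simps power2_eq_square)
      also have "\<dots> = (\<Sum>N\<in>{n..<n+d}. \<delta> / real (2 * n))"
        by simp
      also have "\<dots> \<le> (\<Sum>N\<in>{n..<n+d}. v (Suc N) - v N)"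
        by (intro sum_mono *)
      also have "\<dots> = v (n + d) - v n"
        by (rule sum_Suc_diff') simp
      also have "\<dots> < \<delta>\<^sup>2 / 2"
        using vL[of "n + d"] n elim(1) by simp
      finally show False by simp
    qed
    then obtain N where N: "n \<le> N" "N < n + d" "real (Suc N) * (v (Suc N) - v N) \<le> \<delta>"
      by auto
    \<comment> \<open>The increment splits into the growth of the normalised energy, small by the
      choice of \<open>N\<close>, and the main term \<open>2 * N * v N\<close>, at most
      \<open>2 * N * V\<close>.\<close>
    have "e (Suc N) - e N = real N * (real (Suc N) * (v (Suc N) - v N) + 2 * v N)"
    proof -
      have "e N = real N * (real N - 1) * v N" "e (Suc N) = real (Suc N) * real N * v (Suc N)"
        using N(1) n by (auto simp: v_def)
      then show ?thesis by (simp add: algebra_simps)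
    qed
    also have "\<dots> \<le> real N * (\<delta> + 2 * V)"
      using N n v_le[of N] by (intro mult_left_mono add_mono) auto
    also have "\<dots> \<le> 2 * (real (Suc N) * (V + \<delta>))"
      using \<delta> V_nonneg by (simp add: field_simps)
    finally have "(e (Suc N) - e N) / 2 \<le> real (Suc N) * (V + \<delta>)" by simp
    moreover have "real (Suc N) \<le> (1 + 2 * \<delta>) * real n"
      using N(2) d(2) n(2) by (simp add: algebra_simps)
    ultimately show ?case using N(1) by blast
  qed
qed

section \<open>The weighted space and its composition operators\<close>

text \<open>Radial integration reduces the claim to integrability of the weight on the interval,
  since \<open>2 * pi * x\<close> is bounded there. Functions with bounded derivative therefore
  belong to the space.\<close>

lemma weight_integral_finite:
  assumes "admissible_weight \<omega>"
  shows "(\<integral>\<^sup>+z. indicator unit_disc z * ennreal (\<omega> (cmod z)) \<partial>lborel) < \<infinity>"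
proof -
  define w where "w x = indicator {0..<1} x *\<^sub>R \<omega> x" for x
  have w: "integrable lborel w" and pos: "\<And>x. x \<in> {0..<1} \<Longrightarrow> \<omega> x > 0"
    using assms unfolding admissible_weight_def set_integrable_def w_def by auto
  have [measurable]: "w \<in> borel_measurable borel"
    using w by auto
  have "(\<integral>\<^sup>+z. indicator unit_disc z * ennreal (\<omega> (cmod z)) \<partial>lborel)
      = (\<integral>\<^sup>+z. indicator unit_disc z * ennreal (w (cmod z)) \<partial>lborel)"
    by (intro nn_integral_cong) (auto simp: w_def split: split_indicator)
  also have "\<dots> = (\<integral>\<^sup>+x. ennreal (2 * pi * x) * indicator {0..1} x * ennreal (w x) \<partial>lborel)"
    by (rule nn_integral_radial) measurable
  also have "\<dots> \<le> (\<integral>\<^sup>+x. ennreal (2 * pi) * ennreal (norm (w x)) \<partial>lborel)"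
    by (intro nn_integral_mono mult_mono)
      (auto simp: w_def intro!: ennreal_leI split: split_indicator)
  also have "\<dots> = ennreal (2 * pi) * (\<integral>\<^sup>+x. ennreal (norm (w x)) \<partial>lborel)"
    by (rule nn_integral_cmult) measurable
  also have "\<dots> < \<infinity>"
    using w unfolding integrable_iff_bounded by (simp add: ennreal_mult_less_top)
  finally show ?thesis .
qed

lemma measurable_indicator_disc_times:
  assumes "continuous_on unit_disc g"
  shows "(\<lambda>z. indicator unit_disc z * ennreal (g z)) \<in> borel_measurable borel"
proof -
  have "(\<lambda>z. indicator unit_disc z *\<^sub>R g z) \<in> borel_measurable borel"
    by (intro borel_measurable_continuous_on_indicator assms) auto
  from measurable_compose[OF this measurable_ennreal]
  have "(\<lambda>z. ennreal (indicator unit_disc z *\<^sub>R g z)) \<in> borel_measurable borel" .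
  moreover have "(\<lambda>z. ennreal (indicator unit_disc z *\<^sub>R g z)) = (\<lambda>z. indicator unit_disc z * ennreal (g z))"
    by (auto simp: fun_eq_iff split: split_indicator)
  ultimately show ?thesis by (simp only:)
qed

lemma continuous_on_weight:
  assumes "admissible_weight \<omega>"
  shows "continuous_on unit_disc (\<lambda>z. \<omega> (cmod z))"
proof (rule continuous_on_compose2[where f = cmod])
  show "continuous_on {0..<1} \<omega>" using assms by (simp add: admissible_weight_def)
  show "continuous_on unit_disc cmod" by (rule continuous_on_norm_id)
qed auto

lemma weight_pos: "admissible_weight \<omega> \<Longrightarrow> z \<in> unit_disc \<Longrightarrow> \<omega> (cmod z) > 0"
  by (auto simp: admissible_weight_def)

lemma measurable_dirichlet_density:
  assumes "admissible_weight \<omega>" "f holomorphic_on unit_disc"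
  shows "(\<lambda>z. indicator unit_disc z * ennreal ((cmod (deriv f z))\<^sup>2 * \<omega> (cmod z))) \<in> borel_measurable borel"
proof -
  have "continuous_on unit_disc (deriv f)"
    using holomorphic_deriv[OF assms(2)] by (auto intro: holomorphic_on_imp_continuous_on)
  then have "continuous_on unit_disc (\<lambda>z. (cmod (deriv f z))\<^sup>2 * \<omega> (cmod z))"
    using continuous_on_weight[OF assms(1)] by (intro continuous_on_mult continuous_on_power continuous_on_norm)
  then show ?thesis by (rule measurable_indicator_disc_times)
qed

lemma weight_lower_bound:
  assumes "admissible_weight \<omega>" "0 \<le> s" "s < 1"
  obtains m where "m > 0" "\<And>x. 0 \<le> x \<Longrightarrow> x \<le> s \<Longrightarrow> m \<le> \<omega> x"
proof -
  have "continuous_on {0..s} \<omega>"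
    using assms by (auto simp: admissible_weight_def intro: continuous_on_subset[where s = "{0..<1}"])
  then obtain x where "x \<in> {0..s}" "\<forall>y\<in>{0..s}. \<omega> x \<le> \<omega> y"
    using continuous_attains_inf[of "{0..s}" \<omega>] assms by auto
  then show thesis
    using assms by (intro that[of "\<omega> x"]) (auto simp: admissible_weight_def)
qed

lemma wnorm_Hw:
  assumes "f \<in> Hw \<omega>"
  shows "wnorm \<omega> f = ennreal (sqrt (enn2real (wnorm2 \<omega> f)))"
  using assms by (auto simp: wnorm_def Hw_def)

lemma enn2real_wnorm_square:
  assumes "f \<in> Hw \<omega>"
  shows "ennreal ((enn2real (wnorm \<omega> f))\<^sup>2) = wnorm2 \<omega> f"
  using assms by (simp add: wnorm_Hw) (auto simp: Hw_def)

lemma wnorm_le_iff: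
  assumes "c \<ge> 0"
  shows "wnorm \<omega> f \<le> ennreal c \<longleftrightarrow> wnorm2 \<omega> f \<le> ennreal (c\<^sup>2)"
proof (cases "wnorm2 \<omega> f")
  case (real r)
  then have "sqrt r \<le> c \<longleftrightarrow> r \<le> c\<^sup>2"
    using assms by (meson real_le_lsqrt real_sqrt_le_iff sqrt_le_D)
  then show ?thesis using real assms by (simp add: wnorm_def)
qed (simp add: wnorm_def top_unique)

section \<open>Bounded point evaluations\<close>

text \<open>The area mean inequality for the square of the derivative on a small disc about the
  point, where the weight has a positive lower bound.\<close>

lemma Hw_deriv_bound:
  assumes \<omega>: "admissible_weight \<omega>" and s: "0 \<le> s" "s < 1"
  obtains C where "C > 0"
    "\<And>f \<zeta>. f \<in> Hw \<omega> \<Longrightarrow> cmod \<zeta> \<le> s \<Longrightarrow> cmod (deriv f \<zeta>) \<le> C * enn2real (wnorm \<omega> f)"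
proof -
  \<comment> \<open>Half the distance to the unit circle: all discs of this radius centred in
    \<open>cball 0 s\<close> stay in the compact disc of radius
    \<open>s + \<rho> < 1\<close>.\<close>
  define \<rho> where "\<rho> = (1 - s) / 2"
  have \<rho>: "\<rho> > 0" "s + \<rho> < 1" "0 \<le> s + \<rho>"
    using s by (auto simp: \<rho>_def field_simps)
  obtain m where m: "m > 0" "\<And>x. 0 \<le> x \<Longrightarrow> x \<le> s + \<rho> \<Longrightarrow> m \<le> \<omega> x"
    using weight_lower_bound[OF \<omega> \<rho>(3,2)] by metis
  \<comment> \<open>Read off from the final estimate
    \<open>pi * \<rho>^2 * |f'|^2 \<le> pi * W^2 / m\<close>.\<close>
  define C where "C = 1 / (sqrt m * \<rho>)"
  have C2: "C\<^sup>2 = 1 / (m * \<rho>\<^sup>2)"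
    using m by (simp add: C_def power_divide power_mult_distrib)
  have "cmod (deriv f \<zeta>) \<le> C * enn2real (wnorm \<omega> f)" if f: "f \<in> Hw \<omega>" and \<zeta>: "cmod \<zeta> \<le> s" for f \<zeta>
  proof -
    define W where "W = enn2real (wnorm \<omega> f)"
    have W: "W \<ge> 0" "wnorm2 \<omega> f = ennreal (W\<^sup>2)"
      using enn2real_wnorm_square[OF f] by (auto simp: W_def)
    have hol: "f holomorphic_on unit_disc" using f by (simp add: Hw_def)
    let ?J = "\<integral>\<^sup>+z. indicator unit_disc z * ennreal ((cmod (deriv f z))\<^sup>2 * \<omega> (cmod z)) \<partial>lborel"
    have in_disc: "cmod z \<le> s + \<rho>" if "z \<in> ball \<zeta> \<rho>" for z
      using that \<zeta> norm_triangle_ineq4[of \<zeta> "\<zeta> - z"] by (simp add: dist_norm)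
    then have sub: "ball \<zeta> \<rho> \<subseteq> unit_disc"
      using \<rho> by force
    have "(\<lambda>z. (deriv f z)\<^sup>2) holomorphic_on ball \<zeta> \<rho>"
      by (intro holomorphic_intros holomorphic_on_subset[OF holomorphic_deriv[OF hol] sub]) auto
    from area_mean_bound[OF this \<rho>(1)]
    have "ennreal (pi * \<rho>\<^sup>2 * (cmod (deriv f \<zeta>))\<^sup>2)
        \<le> (\<integral>\<^sup>+z. indicator (ball \<zeta> \<rho>) z * ennreal ((cmod (deriv f z))\<^sup>2) \<partial>lborel)"
      by (simp add: norm_power)
    also have "\<dots> \<le> (\<integral>\<^sup>+z. ennreal (1 / m) *
        (indicator unit_disc z * ennreal ((cmod (deriv f z))\<^sup>2 * \<omega> (cmod z))) \<partial>lborel)"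
    proof (rule nn_integral_mono)
      fix z
      show "indicator (ball \<zeta> \<rho>) z * ennreal ((cmod (deriv f z))\<^sup>2) \<le> ennreal (1 / m) *
        (indicator unit_disc z * ennreal ((cmod (deriv f z))\<^sup>2 * \<omega> (cmod z)))"
      proof (cases "z \<in> ball \<zeta> \<rho>")
        case True
        then have "m \<le> \<omega> (cmod z)" using m(2) in_disc by simp
        then have "(cmod (deriv f z))\<^sup>2 \<le> 1 / m * ((cmod (deriv f z))\<^sup>2 * \<omega> (cmod z))"
          using m(1) by (simp add: field_simps mult_right_mono)
        then show ?thesis
          using True sub m by (simp add: ennreal_mult'[symmetric] ennreal_leI subset_iff)
      qed simp
    qed
    also have "\<dots> = ennreal (1 / m) * ?J"
      by (rule nn_integral_cmult) (use measurable_dirichlet_density[OF \<omega> hol] in simp)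
    also have "?J = ennreal pi * (ennreal (1 / pi) * ?J)"
      by (simp add: mult.assoc[symmetric] ennreal_mult'[symmetric])
    also have "ennreal (1 / m) * \<dots> \<le> ennreal (1 / m) * (ennreal pi * ennreal (W\<^sup>2))"
      unfolding W(2)[symmetric] wnorm2_def by (intro mult_left_mono) auto
    also have "\<dots> = ennreal (pi * W\<^sup>2 / m)"
      using m by (simp add: ennreal_mult'[symmetric] field_simps)
    finally have "pi * \<rho>\<^sup>2 * (cmod (deriv f \<zeta>))\<^sup>2 \<le> pi * W\<^sup>2 / m"
      using m by (subst (asm) ennreal_le_iff) auto
    then have "pi * (\<rho>\<^sup>2 * (cmod (deriv f \<zeta>))\<^sup>2) \<le> pi * (W\<^sup>2 / m)"
      by simp
    then have "(cmod (deriv f \<zeta>))\<^sup>2 \<le> (C * W)\<^sup>2"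
      unfolding power_mult_distrib C2 using m \<rho>(1) by (simp add: field_simps)
    moreover have "C * W \<ge> 0" using W m \<rho> by (simp add: C_def)
    ultimately show ?thesis unfolding W_def by (rule power2_le_imp_le)
  qed
  moreover have "C > 0" using m \<rho> by (simp add: C_def)
  ultimately show thesis by (rule that[rotated])
qed

text \<open>The value at 0 is part of the norm, and the derivative bound on \<open>cball 0 s\<close>
  controls the difference from it.\<close>

lemma Hw_eval_bound:
  assumes \<omega>: "admissible_weight \<omega>" and s: "0 \<le> s" "s < 1"
  obtains C where "C > 0"
    "\<And>f \<zeta>. f \<in> Hw \<omega> \<Longrightarrow> cmod \<zeta> \<le> s \<Longrightarrow> cmod (f \<zeta>) \<le> C * enn2real (wnorm \<omega> f)"
proof -
  obtain C where C: "C > 0"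
    "\<And>f \<zeta>. f \<in> Hw \<omega> \<Longrightarrow> cmod \<zeta> \<le> s \<Longrightarrow> cmod (deriv f \<zeta>) \<le> C * enn2real (wnorm \<omega> f)"
    by (rule Hw_deriv_bound[OF assms]) (rule that)
  have "cmod (f \<zeta>) \<le> (1 + C) * enn2real (wnorm \<omega> f)" if f: "f \<in> Hw \<omega>" and \<zeta>: "cmod \<zeta> \<le> s" for f \<zeta>
  proof -
    define W where "W = enn2real (wnorm \<omega> f)"
    have W: "W \<ge> 0" "wnorm2 \<omega> f = ennreal (W\<^sup>2)"
      using enn2real_wnorm_square[OF f] by (auto simp: W_def)
    have hol: "f holomorphic_on unit_disc" using f by (simp add: Hw_def)
    have "ennreal ((cmod (f 0))\<^sup>2) \<le> ennreal (W\<^sup>2)"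
      unfolding W(2)[symmetric] wnorm2_def by simp
    then have "(cmod (f 0))\<^sup>2 \<le> W\<^sup>2"
      by (subst (asm) ennreal_le_iff) auto
    from power2_le_imp_le[OF this W(1)] have f0: "cmod (f 0) \<le> W" .
    have "cmod (f \<zeta> - f 0) \<le> (C * W) * cmod (\<zeta> - 0)"
    proof (rule field_differentiable_bound[of "cball 0 s"])
      fix z :: complex assume "z \<in> cball 0 s"
      then show "(f has_field_derivative deriv f z) (at z within cball 0 s)"
        using s by (intro holomorphic_derivI[OF hol]) auto
      show "cmod (deriv f z) \<le> C * W"
        using C(2)[OF f] \<open>z \<in> cball 0 s\<close> by (simp add: W_def)
    qed (use s \<zeta> in auto)
    also have "\<dots> \<le> C * W"
      using \<zeta> s W(1) C(1) by (simp add: mult_left_le)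
    finally show ?thesis
      using f0 norm_triangle_ineq2[of "f \<zeta>" "f 0"] by (simp add: W_def algebra_simps)
  qed
  moreover have "1 + C > 0" using C(1) by simp
  ultimately show thesis by (rule that[rotated])
qed

section \<open>Functions with bounded derivative\<close>

lemma wnorm2_bounded_deriv:
  assumes \<omega>: "admissible_weight \<omega>" and f: "\<And>z. z \<in> unit_disc \<Longrightarrow> cmod (deriv f z) \<le> B"
  shows "wnorm2 \<omega> f \<le> ennreal ((cmod (f 0))\<^sup>2) + ennreal (1 / pi) * (ennreal (B\<^sup>2) *
      (\<integral>\<^sup>+z. indicator unit_disc z * ennreal (\<omega> (cmod z)) \<partial>lborel))"
proof -
  have "(\<integral>\<^sup>+z. indicator unit_disc z * ennreal ((cmod (deriv f z))\<^sup>2 * \<omega> (cmod z)) \<partial>lborel) \<le>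
    (\<integral>\<^sup>+z. ennreal (B\<^sup>2) * (indicator unit_disc z * ennreal (\<omega> (cmod z))) \<partial>lborel)"
  proof (rule nn_integral_mono)
    fix z
    show "indicator unit_disc z * ennreal ((cmod (deriv f z))\<^sup>2 * \<omega> (cmod z)) \<le>
        ennreal (B\<^sup>2) * (indicator unit_disc z * ennreal (\<omega> (cmod z)))"
    proof (cases "z \<in> unit_disc")
      case True
      then have "(cmod (deriv f z))\<^sup>2 * \<omega> (cmod z) \<le> B\<^sup>2 * \<omega> (cmod z)"
        using f weight_pos[OF \<omega>, of z] by (intro mult_right_mono power_mono) auto
      then show ?thesis
        using True by (simp add: ennreal_mult'[symmetric] ennreal_leI)
    qed simp
  qed
  also have "\<dots> = ennreal (B\<^sup>2) * (\<integral>\<^sup>+z. indicator unit_disc z * ennreal (\<omega> (cmod z)) \<partial>lborel)"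
    by (rule nn_integral_cmult)
      (use measurable_indicator_disc_times[OF continuous_on_weight[OF \<omega>]] in simp)
  finally show ?thesis
    unfolding wnorm2_def by (intro add_left_mono mult_left_mono) auto
qed

lemma Hw_bounded_deriv:
  assumes "admissible_weight \<omega>" "f holomorphic_on unit_disc"
    "\<And>z. z \<in> unit_disc \<Longrightarrow> cmod (deriv f z) \<le> B"
  shows "f \<in> Hw \<omega>"
proof -
  have "wnorm2 \<omega> f < \<infinity>"
    by (rule le_less_trans[OF wnorm2_bounded_deriv[OF assms(1,3)]])
      (use weight_integral_finite[OF assms(1)] in \<open>simp_all add: ennreal_mult_less_top\<close>)
  then show ?thesis using assms(2) by (simp add: Hw_def)
qed

lemma wnorm_bounded_deriv:
  assumes \<omega>: "admissible_weight \<omega>"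
  obtains C where "C \<ge> 1"
    "\<And>f B. cmod (f 0) \<le> B \<Longrightarrow> (\<forall>z\<in>unit_disc. cmod (deriv f z) \<le> B) \<Longrightarrow>
       wnorm \<omega> f \<le> ennreal (C * B)"
proof -
  obtain J where J: "J \<ge> 0" "(\<integral>\<^sup>+z. indicator unit_disc z * ennreal (\<omega> (cmod z)) \<partial>lborel) = ennreal J"
    using weight_integral_finite[OF \<omega>]
    by (cases "\<integral>\<^sup>+z. indicator unit_disc z * ennreal (\<omega> (cmod z)) \<partial>lborel") auto
  \<comment> \<open>The value at 0 contributes at most \<open>B^2\<close> to the squared norm and
    the Dirichlet integral at most \<open>B^2 * J / pi\<close>, with \<open>J\<close> the mass of
    the weight on the disc.\<close>
  define C where "C = sqrt (1 + J / pi)"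
  have C2: "C\<^sup>2 = 1 + J / pi" using J by (simp add: C_def)
  have "wnorm \<omega> f \<le> ennreal (C * B)"
    if "cmod (f 0) \<le> B" "\<forall>z\<in>unit_disc. cmod (deriv f z) \<le> B" for f B
  proof -
    have B: "B \<ge> 0" using that(1) norm_ge_zero order_trans by blast
    have "wnorm2 \<omega> f \<le> ennreal ((cmod (f 0))\<^sup>2) + ennreal (1 / pi) * (ennreal (B\<^sup>2) * ennreal J)"
      using wnorm2_bounded_deriv[OF \<omega>, of f B] that(2) J by simp
    also have "\<dots> \<le> ennreal (B\<^sup>2) + ennreal (1 / pi) * (ennreal (B\<^sup>2) * ennreal J)"
      using that(1) by (intro add_right_mono ennreal_leI power_mono) auto
    also have "\<dots> = ennreal ((C * B)\<^sup>2)"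
      unfolding power_mult_distrib C2 using J
      by (simp add: ennreal_mult'[symmetric] ennreal_plus[symmetric] algebra_simps del: ennreal_plus)
    finally show ?thesis
      using B J by (subst wnorm_le_iff) (auto simp: C_def)
  qed
  moreover have "C \<ge> 1" using J by (simp add: C_def)
  ultimately show thesis by (rule that[rotated])
qed

text \<open>The disc is open, so agreement on it forces agreement of the derivatives there. This
  allows total functions to be treated as functions on the disc.\<close>

lemma wnorm2_cong:
  assumes "\<And>z. z \<in> unit_disc \<Longrightarrow> f z = g z"
  shows "wnorm2 \<omega> f = wnorm2 \<omega> g"
proof -
  have "deriv f z = deriv g z" if "z \<in> unit_disc" for z
  proof (rule deriv_cong_ev[OF _ refl])
    have "\<forall>\<^sub>F w in nhds z. w \<in> unit_disc"
      using that by (intro eventually_nhds_in_open) auto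
    then show "\<forall>\<^sub>F w in nhds z. f w = g w"
      by (rule eventually_mono) (rule assms)
  qed
  then have "indicator unit_disc z * ennreal ((cmod (deriv f z))\<^sup>2 * \<omega> (cmod z)) =
      indicator unit_disc z * ennreal ((cmod (deriv g z))\<^sup>2 * \<omega> (cmod z))" for z
    by (cases "z \<in> unit_disc") auto
  then show ?thesis
    unfolding wnorm2_def using assms[of 0] by simp
qed

lemma wnorm_cong:
  assumes "\<And>z. z \<in> unit_disc \<Longrightarrow> f z = g z"
  shows "wnorm \<omega> f = wnorm \<omega> g"
  using wnorm2_cong[OF assms] by (simp add: wnorm_def)

section \<open>Composition operators and approximation numbers\<close>

lemma sup_disc_bound:
  fixes \<phi> :: "complex \<Rightarrow> complex"
  assumes "\<phi> ` unit_disc \<subseteq> unit_disc" "(SUP z \<in> unit_disc. cmod (\<phi> z)) < 1"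
  obtains r where "0 \<le> r" "r < 1" "\<forall>z\<in>unit_disc. cmod (\<phi> z) \<le> r"
proof -
  have bdd: "bdd_above ((\<lambda>z. cmod (\<phi> z)) ` unit_disc)"
    using assms(1) by (intro bdd_aboveI[of _ 1]) force
  have le: "cmod (\<phi> z) \<le> (SUP z \<in> unit_disc. cmod (\<phi> z))" if "z \<in> unit_disc" for z
    using bdd that by (rule cSUP_upper2) auto
  show thesis
    using assms(2) le order_trans[OF norm_ge_zero le[of 0]]
    by (intro that[of "SUP z \<in> unit_disc. cmod (\<phi> z)"]) auto
qed

text \<open>The range of \<open>\<phi>\<close> lies in \<open>cball 0 r\<close>, where values and
  derivatives of \<open>f\<close> are controlled by its norm. By the chain rule the Dirichlet
  integral of \<open>f \<circ> \<phi>\<close> is at most a multiple of that of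
  \<open>\<phi>\<close>, finite since \<open>\<phi>\<close> lies in the space.\<close>

lemma comp_op_bounded:
  assumes \<omega>: "admissible_weight \<omega>" and \<phi>: "\<phi> \<in> Hw \<omega>"
    and r: "0 \<le> r" "r < 1" "\<And>z. z \<in> unit_disc \<Longrightarrow> cmod (\<phi> z) \<le> r"
  shows "f \<in> Hw \<omega> \<Longrightarrow> comp_op \<phi> f \<in> Hw \<omega>" and "op_norm \<omega> (comp_op \<phi>) < \<infinity>"
proof -
  obtain A where A: "A > 0"
    "\<And>f \<zeta>. f \<in> Hw \<omega> \<Longrightarrow> cmod \<zeta> \<le> r \<Longrightarrow> cmod (f \<zeta>) \<le> A * enn2real (wnorm \<omega> f)"
    by (rule Hw_eval_bound[OF \<omega> r(1,2)]) (rule that)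
  obtain B where B: "B > 0"
    "\<And>f \<zeta>. f \<in> Hw \<omega> \<Longrightarrow> cmod \<zeta> \<le> r \<Longrightarrow> cmod (deriv f \<zeta>) \<le> B * enn2real (wnorm \<omega> f)"
    by (rule Hw_deriv_bound[OF \<omega> r(1,2)]) (rule that)
  define P where "P = enn2real (wnorm \<omega> \<phi>)"
  have P: "P \<ge> 0" "wnorm2 \<omega> \<phi> = ennreal (P\<^sup>2)"
    using enn2real_wnorm_square[OF \<phi>] by (auto simp: P_def)
  have hol: "\<phi> holomorphic_on unit_disc" using \<phi> by (simp add: Hw_def)
  have img: "\<phi> ` unit_disc \<subseteq> unit_disc"
    using le_less_trans[OF r(3) r(2)] by auto
  let ?D = "sqrt (A\<^sup>2 + B\<^sup>2 * P\<^sup>2)"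
  have bound: "wnorm2 \<omega> (comp_op \<phi> f) \<le> ennreal ((?D * enn2real (wnorm \<omega> f))\<^sup>2)" if f: "f \<in> Hw \<omega>" for f
  proof -
    define W where "W = enn2real (wnorm \<omega> f)"
    have W: "W \<ge> 0" by (simp add: W_def)
    have fhol: "f holomorphic_on unit_disc" using f by (simp add: Hw_def)
    let ?J = "\<integral>\<^sup>+z. indicator unit_disc z * ennreal ((cmod (deriv \<phi> z))\<^sup>2 * \<omega> (cmod z)) \<partial>lborel"
    have "(\<integral>\<^sup>+z. indicator unit_disc z * ennreal ((cmod (deriv (comp_op \<phi> f) z))\<^sup>2 * \<omega> (cmod z)) \<partial>lborel) \<le>
        (\<integral>\<^sup>+z. ennreal ((B * W)\<^sup>2) * (indicator unit_disc z * ennreal ((cmod (deriv \<phi> z))\<^sup>2 * \<omega> (cmod z))) \<partial>lborel)"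
    proof (rule nn_integral_mono)
      fix z
      show "indicator unit_disc z * ennreal ((cmod (deriv (comp_op \<phi> f) z))\<^sup>2 * \<omega> (cmod z)) \<le>
        ennreal ((B * W)\<^sup>2) * (indicator unit_disc z * ennreal ((cmod (deriv \<phi> z))\<^sup>2 * \<omega> (cmod z)))"
      proof (cases "z \<in> unit_disc")
        case True
        then have z: "cmod (\<phi> z) \<le> r" "\<phi> z \<in> unit_disc" using r(3)[OF True] img True by blast+
        have "deriv (f \<circ> \<phi>) z = deriv f (\<phi> z) * deriv \<phi> z"
          using True z(2) fhol hol
          by (intro deriv_chain) (auto simp: holomorphic_on_imp_differentiable_at)
        then have "(cmod (deriv (comp_op \<phi> f) z))\<^sup>2 * \<omega> (cmod z) \<le> (B * W)\<^sup>2 * ((cmod (deriv \<phi> z))\<^sup>2 * \<omega> (cmod z))"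
          using B(2)[OF f z(1)] weight_pos[OF \<omega> True] unfolding comp_op_def W_def
          by (simp add: norm_mult power_mult_distrib mult.assoc[symmetric])
             (intro mult_right_mono, simp_all flip: power_mult_distrib add: power_mono)
        then show ?thesis
          using True by (simp add: ennreal_mult'[symmetric] ennreal_leI)
      qed simp
    qed
    also have "\<dots> = ennreal ((B * W)\<^sup>2) * ?J"
      by (rule nn_integral_cmult) (use measurable_dirichlet_density[OF \<omega> hol] in simp)
    finally have "ennreal (1 / pi) * (\<integral>\<^sup>+z. indicator unit_disc z * ennreal ((cmod (deriv (comp_op \<phi> f) z))\<^sup>2 * \<omega> (cmod z)) \<partial>lborel)
       \<le> ennreal (1 / pi) * (ennreal ((B * W)\<^sup>2) * ?J)"
      by (rule mult_left_mono) simp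
    also have "\<dots> = ennreal ((B * W)\<^sup>2) * (ennreal (1 / pi) * ?J)"
      by (simp add: mult_ac)
    also have "\<dots> \<le> ennreal ((B * W)\<^sup>2) * ennreal (P\<^sup>2)"
      unfolding P(2)[symmetric] wnorm2_def by (intro mult_left_mono) auto
    also have "\<dots> = ennreal (B\<^sup>2 * P\<^sup>2 * W\<^sup>2)"
      by (simp add: ennreal_mult'[symmetric] power_mult_distrib mult_ac)
    finally have 1: "ennreal (1 / pi) * (\<integral>\<^sup>+z. indicator unit_disc z * ennreal ((cmod (deriv (comp_op \<phi> f) z))\<^sup>2 * \<omega> (cmod z)) \<partial>lborel)
       \<le> ennreal (B\<^sup>2 * P\<^sup>2 * W\<^sup>2)" .
    have 2: "ennreal ((cmod (comp_op \<phi> f 0))\<^sup>2) \<le> ennreal (A\<^sup>2 * W\<^sup>2)"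
      using A(2)[OF f r(3)[of 0]] unfolding comp_op_def W_def
      by (intro ennreal_leI) (simp flip: power_mult_distrib add: power_mono)
    show ?thesis
      unfolding wnorm2_def W_def[symmetric]
      using add_mono[OF 2 1] by (simp add: power_mult_distrib distrib_right)
  qed
  show "f \<in> Hw \<omega> \<Longrightarrow> comp_op \<phi> f \<in> Hw \<omega>"
  proof -
    assume f: "f \<in> Hw \<omega>"
    have "f \<circ> \<phi> holomorphic_on unit_disc"
      using f by (intro holomorphic_on_compose[OF hol holomorphic_on_subset[OF _ img]]) (simp add: Hw_def)
    moreover have "wnorm2 \<omega> (comp_op \<phi> f) < \<infinity>"
      using bound[OF f] by (rule le_less_trans) simp
    ultimately show ?thesis by (simp add: Hw_def comp_op_def)
  qed
  have "op_norm \<omega> (comp_op \<phi>) \<le> ennreal ?D"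
    unfolding op_norm_def
  proof (rule SUP_least)
    fix f assume f: "f \<in> {f \<in> Hw \<omega>. wnorm \<omega> f \<le> 1}"
    then have "enn2real (wnorm \<omega> f) \<le> 1"
      by (simp add: enn2real_leI)
    then have "(?D * enn2real (wnorm \<omega> f))\<^sup>2 \<le> ?D\<^sup>2"
      by (intro power_mono) (auto simp: mult_left_le)
    with f have "wnorm2 \<omega> (comp_op \<phi> f) \<le> ennreal (?D\<^sup>2)"
      by (intro order_trans[OF bound ennreal_leI]) simp_all
    then show "wnorm \<omega> (comp_op \<phi> f) \<le> ennreal ?D"
      by (subst wnorm_le_iff) simp_all
  qed
  also have "\<dots> < \<infinity>" by simp
  finally show "op_norm \<omega> (comp_op \<phi>) < \<infinity>" .
qed

text \<open>The zero operator is a competitor. Together with boundedness of the composition operator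
  this makes the approximation numbers finite, so \<open>enn2real\<close> loses nothing.\<close>

lemma approx_num_le_op_norm:
  assumes "admissible_weight \<omega>" "n \<ge> 1"
  shows "approx_num \<omega> T n \<le> op_norm \<omega> T"
proof -
  have "(\<lambda>_. 0) \<in> Hw \<omega>"
    by (rule Hw_bounded_deriv[OF assms(1), of _ 0]) auto
  then have "(\<lambda>_ _. 0) \<in> rank_less_ops \<omega> n"
    using assms(2) unfolding rank_less_ops_def mem_Collect_eq
    by (intro conjI exI[of _ "\<lambda>_ _. 0"]) simp_all
  from INF_lower[OF this, of "\<lambda>R. op_norm \<omega> (\<lambda>f z. T f z - R f z)"] show ?thesis
    by (simp add: approx_num_def)
qed

lemma rank_less_ops_mono:
  assumes "admissible_weight \<omega>" "n \<le> N"
  shows "rank_less_ops \<omega> n \<subseteq> rank_less_ops \<omega> N"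
proof
  fix R assume R: "R \<in> rank_less_ops \<omega> n"
  have 0: "(\<lambda>_. 0) \<in> Hw \<omega>"
    by (rule Hw_bounded_deriv[OF assms(1), of _ 0]) auto
  obtain gs where gs: "\<And>i. i < n - 1 \<Longrightarrow> gs i \<in> Hw \<omega>"
    "\<And>f. f \<in> Hw \<omega> \<Longrightarrow> \<exists>c. \<forall>z\<in>unit_disc. R f z = (\<Sum>i<n-1. c i * gs i z)"
  proof -
    from R obtain gs where "\<forall>i<n-1. gs i \<in> Hw \<omega>"
      "\<forall>f\<in>Hw \<omega>. \<exists>c. \<forall>z\<in>unit_disc. R f z = (\<Sum>i<n-1. c i * gs i z)"
      unfolding rank_less_ops_def mem_Collect_eq by (elim conjE exE)
    then show thesis by (intro that[of gs]) auto
  qed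
  \<comment> \<open>The spanning family is padded with zero functions.\<close>
  let ?gs = "\<lambda>i. if i < n - 1 then gs i else (\<lambda>_. 0)"
  have "\<exists>c. \<forall>z\<in>unit_disc. R f z = (\<Sum>i<N-1. c i * ?gs i z)" if f: "f \<in> Hw \<omega>" for f
  proof -
    obtain c where c: "\<forall>z\<in>unit_disc. R f z = (\<Sum>i<n-1. c i * gs i z)"
      using gs(2)[OF f] by blast
    have "(\<Sum>i<N-1. c i * ?gs i z) = (\<Sum>i<n-1. c i * gs i z)" for z
      using assms(2) by (intro sum.mono_neutral_cong_right) auto
    then have "\<forall>z\<in>unit_disc. R f z = (\<Sum>i<N-1. c i * ?gs i z)"
      using c by simp
    then show ?thesis by (intro exI[of _ c])
  qed
  moreover have "\<forall>i<N-1. ?gs i \<in> Hw \<omega>" using gs(1) 0 by simp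
  ultimately show "R \<in> rank_less_ops \<omega> N"
    using R assms(2) unfolding rank_less_ops_def mem_Collect_eq
    by (elim conjE, intro conjI exI[of _ ?gs] ballI) simp_all
qed

lemma approx_num_antimono:
  "admissible_weight \<omega> \<Longrightarrow> n \<le> N \<Longrightarrow> approx_num \<omega> T N \<le> approx_num \<omega> T n"
  unfolding approx_num_def by (rule INF_superset_mono[OF rank_less_ops_mono order_refl])

section \<open>Lower bounds from Blaschke products\<close>

text \<open>Gaussian elimination: a pivot \<open>p\<close> of the last equation is eliminated from
  the others, leaving one equation and one unknown less.\<close>

lemma underdetermined_system_nontrivial_solution:
  fixes M :: "nat \<Rightarrow> 'b \<Rightarrow> 'a::field"
  assumes "finite A" "m < card A"
  shows "\<exists>c. (\<exists>k\<in>A. c k \<noteq> 0) \<and> (\<forall>i<m. (\<Sum>k\<in>A. M i k * c k) = 0)"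
  using assms
proof (induction m arbitrary: A M)
  case 0
  then show ?case by (intro exI[of _ "\<lambda>_. 1"]) (auto simp: card_gt_0_iff)
next
  case (Suc m)
  show ?case
  proof (cases "\<forall>k\<in>A. M m k = 0")
    case True
    obtain c where "\<exists>k\<in>A. c k \<noteq> 0" "\<forall>i<m. (\<Sum>k\<in>A. M i k * c k) = 0"
      using Suc.IH[of A M] Suc.prems by auto
    moreover have "(\<Sum>k\<in>A. M m k * c k) = 0"
      using True by (intro sum.neutral) auto
    ultimately show ?thesis by (intro exI[of _ c]) (auto simp: less_Suc_eq)
  next
    case False
    then obtain p where p: "p \<in> A" "M m p \<noteq> 0" by auto
    let ?A = "A - {p}"
    have "finite ?A" "m < card ?A" using Suc.prems p by auto
    obtain c where c: "\<exists>k\<in>?A. c k \<noteq> 0"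
      "\<forall>i<m. (\<Sum>k\<in>?A. (M i k - M i p * M m k / M m p) * c k) = 0"
      using Suc.IH[of ?A "\<lambda>i k. M i k - M i p * M m k / M m p"] \<open>finite ?A\<close> \<open>m < card ?A\<close>
      by blast
    \<comment> \<open>The eliminated unknown gets the value that solves the last equation.\<close>
    define c' where "c' = c(p := - (\<Sum>k\<in>?A. M m k * c k) / M m p)"
    have eq: "(\<Sum>k\<in>A. M i k * c' k) = (\<Sum>k\<in>?A. (M i k - M i p * M m k / M m p) * c k)" for i
    proof -
      have "(\<Sum>k\<in>A. M i k * c' k) = M i p * c' p + (\<Sum>k\<in>?A. M i k * c' k)"
        using p Suc.prems by (simp add: sum.remove)
      also have "(\<Sum>k\<in>?A. M i k * c' k) = (\<Sum>k\<in>?A. M i k * c k)"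
        by (intro sum.cong) (auto simp: c'_def)
      also have "M i p * c' p = - (\<Sum>k\<in>?A. M i p * M m k / M m p * c k)"
        by (simp add: c'_def sum_distrib_left sum_divide_distrib mult_ac flip: sum_negf)
      finally show ?thesis
        by (simp add: left_diff_distrib sum_subtractf)
    qed
    have "(\<Sum>k\<in>?A. (M m k - M m p * M m k / M m p) * c k) = 0"
      using p by (intro sum.neutral) auto
    then have "\<forall>i<Suc m. (\<Sum>k\<in>A. M i k * c' k) = 0"
      unfolding eq using c(2) by (auto simp: less_Suc_eq)
    moreover have "\<exists>k\<in>A. c' k \<noteq> 0"
      using c(1) by (auto simp: c'_def)
    ultimately show ?thesis by blast
  qed
qed

section \<open>Finite Blaschke products\<close>

text \<open>The usual unimodular constants are omitted; only moduli matter, and off the zeros in the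
  disc the logarithm of the modulus is minus the sum of the Green functions with poles in
  \<open>Z\<close>.\<close>

definition blaschke :: "complex set \<Rightarrow> complex \<Rightarrow> complex" where
  "blaschke Z z = (\<Prod>w\<in>Z. (z - w) / (1 - cnj w * z))"

lemma one_minus_cnj_mult_ge:
  assumes "cmod w \<le> r" "cmod z < 1"
  shows "1 - r \<le> cmod (1 - cnj w * z)"
proof -
  have "cmod (cnj w * z) \<le> r * 1"
    using assms by (simp only: norm_mult complex_mod_cnj) (intro mult_mono, auto intro: order_trans[OF norm_ge_zero])
  then show ?thesis
    using norm_triangle_ineq2[of 1 "cnj w * z"] by simp
qed

text \<open>Equivalently, the Green function is nonnegative on the disc, so that
  \<open>ennreal\<close> in \<open>green\<close> truncates nothing there.\<close>

lemma blaschke_factor_le_1: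
  assumes "cmod w < 1" "cmod z < 1"
  shows "cmod ((z - w) / (1 - cnj w * z)) \<le> 1"
proof -
  have "(cmod (1 - cnj w * z))\<^sup>2 - (cmod (z - w))\<^sup>2 = (1 - (cmod z)\<^sup>2) * (1 - (cmod w)\<^sup>2)"
    unfolding cmod_power2 by (simp add: power2_eq_square algebra_simps)
  also have "\<dots> \<ge> 0"
    using assms by (intro mult_nonneg_nonneg) (auto simp: power_le_one)
  finally have "(cmod (z - w))\<^sup>2 \<le> (cmod (1 - cnj w * z))\<^sup>2" by simp
  then have "cmod (z - w) \<le> cmod (1 - cnj w * z)"
    by (rule power2_le_imp_le) simp
  then show ?thesis
    by (auto simp: norm_divide divide_le_eq_1)
qed

text \<open>In the product rule every factor and partial product is at most 1 in modulus, so each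
  zero adds only a fixed amount to the derivative. The two bounds are proved together because the
  induction step for the derivative uses the bound on the modulus. Linear growth in the number of
  zeros keeps the eventual loss polynomial.\<close>

lemma blaschke_bounds:
  assumes "finite Z" "\<And>w. w \<in> Z \<Longrightarrow> cmod w \<le> r" "r < 1" "cmod z < 1"
  shows "cmod (blaschke Z z) \<le> 1 \<and>
    (\<exists>d. (blaschke Z has_field_derivative d) (at z) \<and> cmod d \<le> real (card Z) * (2 / (1 - r)\<^sup>2))"
  using assms(1,2)
proof (induction Z rule: finite_induct)
  case empty
  then show ?case by (auto simp: blaschke_def[abs_def] intro!: exI[of _ 0])
next
  case (insert w Z)
  then obtain d where d: "(blaschke Z has_field_derivative d) (at z)" "cmod d \<le> real (card Z) * (2 / (1 - r)\<^sup>2)"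
    and le1: "cmod (blaschke Z z) \<le> 1"
    by auto
  have w: "cmod w \<le> r" "cmod w < 1" using insert.prems[of w] assms(3) by auto
  have ge: "1 - r \<le> cmod (1 - cnj w * z)"
    by (rule one_minus_cnj_mult_ge) (use w assms in auto)
  then have nz: "1 - cnj w * z \<noteq> 0" using assms(3) by auto
  let ?b = "(z - w) / (1 - cnj w * z)" and ?b' = "(1 - cnj w * w) / (1 - cnj w * z)\<^sup>2"
  have b': "((\<lambda>z. (z - w) / (1 - cnj w * z)) has_field_derivative ?b') (at z)"
    using nz by (auto intro!: derivative_eq_intros simp: power2_eq_square algebra_simps)
  have b: "cmod ?b \<le> 1" by (rule blaschke_factor_le_1) (use w assms in auto)
  have nb': "cmod ?b' \<le> 2 / (1 - r)\<^sup>2"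
    unfolding norm_divide norm_power
  proof (rule frac_le)
    have "cmod (1 - cnj w * w) \<le> 1 + cmod w * cmod w"
      using norm_triangle_ineq4[of 1 "cnj w * w"] by (simp add: norm_mult)
    also have "\<dots> \<le> 2" using w(2) mult_le_one[of "cmod w" "cmod w"] by simp
    finally show "cmod (1 - cnj w * w) \<le> 2" .
    show "(1 - r)\<^sup>2 \<le> (cmod (1 - cnj w * z))\<^sup>2"
      using ge assms(3) by (intro power_mono) auto
  qed (use assms(3) in auto)
  have eq: "blaschke (insert w Z) = (\<lambda>z. (z - w) / (1 - cnj w * z) * blaschke Z z)"
    using insert.hyps by (auto simp: blaschke_def)
  have der: "(blaschke (insert w Z) has_field_derivative (?b' * blaschke Z z + d * ?b)) (at z)"
    unfolding eq by (rule DERIV_mult[OF b' d(1)])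
  have card: "2 / (1 - r)\<^sup>2 * 1 + (real (card Z) * (2 / (1 - r)\<^sup>2)) * 1
      = real (card (insert w Z)) * (2 / (1 - r)\<^sup>2)"
    using insert.hyps by (simp add: distrib_right add_divide_distrib)
  have norm_d: "cmod (?b' * blaschke Z z + d * ?b) \<le> 2 / (1 - r)\<^sup>2 * 1 + (real (card Z) * (2 / (1 - r)\<^sup>2)) * 1"
    by (rule order_trans[OF norm_triangle_ineq], rule add_mono; unfold norm_mult; rule mult_mono)
      (use nb' le1 d(2) b in auto)
  have "cmod (blaschke (insert w Z) z) \<le> 1"
    unfolding eq norm_mult using b le1 by (intro mult_le_one) auto
  with der norm_d[unfolded card] show ?case by (intro conjI exI)
qed

lemma blaschke_holomorphic:
  assumes "finite Z" "\<And>w. w \<in> Z \<Longrightarrow> cmod w \<le> r" "r < 1"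
  shows "blaschke Z holomorphic_on unit_disc"
proof (rule holomorphic_onI)
  fix z :: complex assume "z \<in> unit_disc"
  then obtain d where "(blaschke Z has_field_derivative d) (at z)"
    using blaschke_bounds[OF assms, of z] by auto
  from has_field_derivative_at_within[OF this]
  show "blaschke Z field_differentiable at z within unit_disc"
    unfolding field_differentiable_def by (rule exI)
qed

lemma blaschke_deriv_bound:
  assumes "finite Z" "\<And>w. w \<in> Z \<Longrightarrow> cmod w \<le> r" "r < 1" "cmod z < 1"
  shows "cmod (deriv (blaschke Z) z) \<le> real (card Z) * (2 / (1 - r)\<^sup>2)"
proof -
  obtain d where "(blaschke Z has_field_derivative d) (at z)" "cmod d \<le> real (card Z) * (2 / (1 - r)\<^sup>2)"
    using blaschke_bounds[OF assms] by auto
  then show ?thesis by (simp add: DERIV_imp_deriv)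
qed

text \<open>Each factor has modulus \<open>exp (- g w)\<close>, so an upper bound on the potential
  at \<open>k\<close> is a lower bound on the product.\<close>

lemma blaschke_lower_bound:
  assumes Z: "finite Z" "\<And>w. w \<in> Z \<Longrightarrow> cmod w < 1" and k: "cmod k < 1" "k \<notin> Z"
    and S: "(\<Sum>w\<in>Z. green k w) \<le> ennreal S" "S \<ge> 0"
  shows "exp (- S) \<le> cmod (blaschke Z k)"
proof -
  define g where "g w = ln (cmod ((1 - cnj w * k) / (k - w)))" for w
  have g: "cmod ((k - w) / (1 - cnj w * k)) = exp (- g w)" "g w \<ge> 0" if "w \<in> Z" for w
  proof -
    have kw: "k \<noteq> w" using that k by auto
    have nz: "1 - cnj w * k \<noteq> 0"
    proof -
      have "1 - cmod w \<le> cmod (1 - cnj w * k)"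
        by (rule one_minus_cnj_mult_ge) (use k in auto)
      then show ?thesis using Z(2)[OF that] by auto
    qed
    show "cmod ((k - w) / (1 - cnj w * k)) = exp (- g w)"
      using kw nz by (simp add: g_def exp_minus norm_divide)
    then show "g w \<ge> 0"
      using blaschke_factor_le_1[OF Z(2)[OF that] k(1)] by simp
  qed
  have "ennreal (\<Sum>w\<in>Z. g w) = (\<Sum>w\<in>Z. green k w)"
  proof -
    have "(\<Sum>w\<in>Z. green k w) = (\<Sum>w\<in>Z. ennreal (g w))"
      using k(2) by (intro sum.cong) (auto simp: green_def g_def)
    also have "\<dots> = ennreal (\<Sum>w\<in>Z. g w)"
      using g(2) by (rule sum_ennreal)
    finally show ?thesis ..
  qed
  then have "ennreal (\<Sum>w\<in>Z. g w) \<le> ennreal S" using S(1) by simp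
  then have "(\<Sum>w\<in>Z. g w) \<le> S" using S(2) by (subst (asm) ennreal_le_iff)
  then have "exp (- S) \<le> exp (- (\<Sum>w\<in>Z. g w))" by simp
  also have "\<dots> = cmod (blaschke Z k)"
    using Z(1) g(1) by (simp add: blaschke_def prod_norm[symmetric] exp_sum sum_negf[symmetric])
  finally show ?thesis .
qed

section \<open>From Green potentials to approximation numbers\<close>

text \<open>Linearity of \<open>R\<close> is available for two summands in
  \<open>Hw \<omega>\<close> and pointwise on the disc; the induction therefore carries membership
  of all partial sums.\<close>

lemma rank_less_ops_sum:
  assumes R: "R \<in> rank_less_ops \<omega> n" and "finite A"
    and B: "\<And>k. k \<in> A \<Longrightarrow> B k \<in> Hw \<omega>"
    and sums: "\<And>S. S \<subseteq> A \<Longrightarrow> (\<lambda>w. \<Sum>k\<in>S. c k * B k w) \<in> Hw \<omega>"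
    and z: "z \<in> unit_disc"
  shows "R (\<lambda>w. \<Sum>k\<in>A. c k * B k w) z = (\<Sum>k\<in>A. c k * R (B k) z)"
proof -
  have lin: "R (\<lambda>w. a * f w + b * g w) z = a * R f z + b * R g z" if "f \<in> Hw \<omega>" "g \<in> Hw \<omega>" for f g a b
    using R z that unfolding rank_less_ops_def by simp
  have "R (\<lambda>w. \<Sum>k\<in>S. c k * B k w) z = (\<Sum>k\<in>S. c k * R (B k) z)" if "S \<subseteq> A" for S
    using finite_subset[OF that \<open>finite A\<close>] that
  proof (induction S rule: finite_induct)
    case empty
    have "(\<lambda>w. 0) \<in> Hw \<omega>" using sums[of "{}"] by simp
    from lin[OF this this, of 0 0] show ?case by simp
  next
    case (insert k S)
    then have "R (\<lambda>w. c k * B k w + 1 * (\<Sum>k\<in>S. c k * B k w)) z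
        = c k * R (B k) z + 1 * R (\<lambda>w. \<Sum>k\<in>S. c k * B k w) z"
      using B sums by (intro lin) auto
    then show ?case using insert by simp
  qed
  then show ?thesis by blast
qed

text \<open>For nonconstant \<open>\<phi>\<close> the images of smaller concentric discs are open by
  the open mapping theorem and cover \<open>K\<close>, so finitely many suffice; for constant
  \<open>\<phi>\<close> the centre suffices. Every point of \<open>K\<close> thus has a preimage in
  one fixed compact disc, which makes the evaluation bound uniform.\<close>

lemma compact_image_subset_smaller_disc:
  assumes \<phi>: "\<phi> holomorphic_on unit_disc" and K: "compact K" "K \<subseteq> \<phi> ` unit_disc"
  obtains s where "0 \<le> s" "s < 1" "K \<subseteq> \<phi> ` cball 0 s"
proof (cases "\<phi> constant_on unit_disc")
  case True
  then have "K \<subseteq> \<phi> ` cball 0 0"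
    using K(2) by (fastforce simp: constant_on_def)
  then show thesis using that[of 0] by simp
next
  case False
  define U where "U n = \<phi> ` ball 0 (1 - 1 / real (Suc n))" for n
  have op: "open (U n)" for n
    unfolding U_def
    by (rule open_mapping_thm[OF \<phi> _ _ _ _ False])
      (use subset_ball[of "1 - 1 / real (Suc n)" 1 "0::complex"] in auto)
  have cover: "\<exists>n. z \<in> ball 0 (1 - 1 / real (Suc n))" if z: "z \<in> unit_disc" for z :: complex
  proof -
    obtain n where "inverse (real (Suc n)) < 1 - cmod z"
      using reals_Archimedean[of "1 - cmod z"] z by auto
    then show ?thesis by (intro exI[of _ n]) (auto simp: inverse_eq_divide)
  qed
  have "K \<subseteq> (\<Union>n. U n)"
  proof
    fix w assume "w \<in> K"
    then obtain z where z: "z \<in> unit_disc" "w = \<phi> z" using K(2) by blast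
    from cover[OF z(1)] z(2) show "w \<in> (\<Union>n. U n)" unfolding U_def by blast
  qed
  then obtain I where I: "finite I" "K \<subseteq> (\<Union>n\<in>I. U n)"
    by (rule compactE_image[OF K(1) op]) (rule that)
  obtain N where N: "\<forall>n\<in>I. n \<le> N"
    using finite_nat_set_iff_bounded_le[of I] I(1) by blast
  have "U n \<subseteq> \<phi> ` cball 0 (1 - 1 / real (Suc N))" if "n \<in> I" for n
  proof -
    have "1 - 1 / real (Suc n) \<le> 1 - 1 / real (Suc N)"
      using N that by (simp add: frac_le)
    then show ?thesis unfolding U_def by (intro image_mono) auto
  qed
  then have "K \<subseteq> \<phi> ` cball 0 (1 - 1 / real (Suc N))"
    using I(2) by blast
  then show thesis by (intro that[of "1 - 1 / real (Suc N)"]) auto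
qed

lemma op_norm_ge:
  assumes "f \<in> Hw \<omega>" "wnorm \<omega> f \<le> 1"
  shows "wnorm \<omega> (T f) \<le> op_norm \<omega> T"
  unfolding op_norm_def using assms by (intro SUP_upper) auto

text \<open>A unit-ball function killed by \<open>R\<close>, whose composition with
  \<open>\<phi>\<close> is large at one preimage, bounds the distance to \<open>R\<close> from
  below. The constant collects evaluation (\<open>E\<close>), passage from derivative bounds to
  norms (\<open>F\<close>) and the derivative of one Blaschke factor (\<open>D\<close>); it is
  independent of \<open>Z\<close> and \<open>S\<close>, so it is harmless after \<open>n\<close>-th
  roots.\<close>

lemma approx_num_lower_bound:
  assumes \<omega>: "admissible_weight \<omega>" and \<phi>: "\<phi> \<in> Hw \<omega>"
    and r: "0 \<le> r" "r < 1" "\<And>z. z \<in> unit_disc \<Longrightarrow> cmod (\<phi> z) \<le> r"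
    and K: "compact K" "K \<subseteq> \<phi> ` unit_disc"
  obtains C where "C > 0"
    "\<And>Z S. finite Z \<Longrightarrow> Z \<noteq> {} \<Longrightarrow> Z \<subseteq> K \<Longrightarrow> S \<ge> 0 \<Longrightarrow>
      \<forall>k\<in>Z. (\<Sum>w\<in>Z - {k}. green k w) \<le> ennreal S \<Longrightarrow>
      ennreal (exp (- S) / (C * (real (card Z))\<^sup>2)) \<le> approx_num \<omega> (comp_op \<phi>) (card Z)"
proof -
  have hol: "\<phi> holomorphic_on unit_disc" using \<phi> by (simp add: Hw_def)
  obtain s where s: "0 \<le> s" "s < 1" "K \<subseteq> \<phi> ` cball 0 s"
    using compact_image_subset_smaller_disc[OF hol K] by metis
  obtain E where E: "E > 0"
    "\<And>f \<zeta>. f \<in> Hw \<omega> \<Longrightarrow> cmod \<zeta> \<le> s \<Longrightarrow> cmod (f \<zeta>) \<le> E * enn2real (wnorm \<omega> f)"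
    by (rule Hw_eval_bound[OF \<omega> s(1,2)]) (rule that)
  obtain F where F: "F \<ge> 1"
    "\<And>f B. cmod (f 0) \<le> B \<Longrightarrow> (\<forall>z\<in>unit_disc. cmod (deriv f z) \<le> B) \<Longrightarrow>
       wnorm \<omega> f \<le> ennreal (F * B)"
    by (rule wnorm_bounded_deriv[OF \<omega>]) (rule that)
  define D where "D = 2 / (1 - r)\<^sup>2"
  have D: "D \<ge> 1"
  proof -
    have "(1 - r)\<^sup>2 \<le> 1" using r by (simp add: power_le_one)
    then show ?thesis using r by (simp add: D_def field_simps)
  qed
  define C where "C = E * F * D"
  have C: "C > 0" using E F D by (simp add: C_def)
  show thesis
  proof (rule that[OF C])
    fix Z S
    assume Z: "finite Z" "Z \<noteq> {}" "Z \<subseteq> K" and S: "S \<ge> 0"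
      and pot: "\<forall>k\<in>Z. (\<Sum>w\<in>Z - {k}. green k w) \<le> ennreal S"
    define N where "N = card Z"
    have N: "N \<ge> 1" using Z by (simp add: N_def Suc_le_eq card_gt_0_iff)
    have Zr: "cmod w \<le> r" if "w \<in> Z" for w
      using that Z(3) K(2) r(3) by auto
    define B where "B k = blaschke (Z - {k})" for k
    have Bhol: "B k holomorphic_on unit_disc" for k
      unfolding B_def by (rule blaschke_holomorphic[of _ r]) (use Z Zr r in auto)
    have B1: "cmod (B k z) \<le> 1" if "z \<in> unit_disc" for k z
      unfolding B_def using blaschke_bounds[of "Z - {k}" r z] Z Zr r that by auto
    have Bd: "cmod (deriv (B k) z) \<le> real N * D" if "z \<in> unit_disc" for k z
    proof -
      have "cmod (deriv (B k) z) \<le> real (card (Z - {k})) * D"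
        unfolding B_def D_def by (rule blaschke_deriv_bound) (use Z Zr r that in auto)
      also have "\<dots> \<le> real N * D"
        using Z D by (intro mult_right_mono) (auto simp: N_def card_Diff1_le)
      finally show ?thesis .
    qed
    have comb_hol: "(\<lambda>w. \<Sum>k\<in>A. c k * B k w) holomorphic_on unit_disc" for c A
      by (intro holomorphic_intros Bhol)
    have comb_deriv: "cmod (deriv (\<lambda>w. \<Sum>k\<in>A. c k * B k w) z) \<le> (\<Sum>k\<in>A. cmod (c k)) * (real N * D)"
      if z: "z \<in> unit_disc" for c A z
    proof -
      have "((\<lambda>w. \<Sum>k\<in>A. c k * B k w) has_field_derivative (\<Sum>k\<in>A. c k * deriv (B k) z)) (at z)"
        using z by (intro DERIV_sum DERIV_cmult holomorphic_derivI[OF Bhol]) auto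
      then have "deriv (\<lambda>w. \<Sum>k\<in>A. c k * B k w) z = (\<Sum>k\<in>A. c k * deriv (B k) z)"
        by (rule DERIV_imp_deriv)
      then show ?thesis
        using Bd[OF z] by (auto simp: sum_distrib_right norm_mult intro!: sum_norm_le mult_left_mono)
    qed
    have comb: "(\<lambda>w. \<Sum>k\<in>A. c k * B k w) \<in> Hw \<omega>" for c A
      by (rule Hw_bounded_deriv[OF \<omega> comb_hol comb_deriv])
    have BH: "B k \<in> Hw \<omega>" for k
      by (rule Hw_bounded_deriv[OF \<omega> Bhol Bd])
    show "ennreal (exp (- S) / (C * (real (card Z))\<^sup>2)) \<le> approx_num \<omega> (comp_op \<phi>) (card Z)"
      unfolding approx_num_def
    proof (rule INF_greatest)
      fix R assume R: "R \<in> rank_less_ops \<omega> (card Z)"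
      obtain gs where "\<forall>f\<in>Hw \<omega>. \<exists>c. \<forall>z\<in>unit_disc. R f z = (\<Sum>i<N-1. c i * gs i z)"
        using R unfolding rank_less_ops_def mem_Collect_eq N_def by (elim conjE exE)
      then have "\<forall>k. \<exists>c. \<forall>z\<in>unit_disc. R (B k) z = (\<Sum>i<N-1. c i * gs i z)"
        using BH by simp
      then obtain M where M: "\<And>k z. z \<in> unit_disc \<Longrightarrow> R (B k) z = (\<Sum>i<N-1. M k i * gs i z)"
        by metis
      \<comment> \<open>The images \<open>R (B k)\<close> have \<open>N - 1\<close> coordinates
        each, so some nontrivial combination of these \<open>N\<close> vectors vanishes.\<close>
      obtain c0 where c0: "\<exists>k\<in>Z. c0 k \<noteq> 0" "\<forall>i<N-1. (\<Sum>k\<in>Z. M k i * c0 k) = 0"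
        using underdetermined_system_nontrivial_solution[OF Z(1), of "N - 1" "\<lambda>i k. M k i"] N
        by (auto simp: N_def)
      define m where "m = Max ((\<lambda>k. cmod (c0 k)) ` Z)"
      have m: "cmod (c0 k) \<le> m" if "k \<in> Z" for k
        unfolding m_def using that Z by (intro Max_ge) auto
      have "m \<in> (\<lambda>k. cmod (c0 k)) ` Z"
        unfolding m_def using Z by (intro Max_in) auto
      then obtain p where p: "p \<in> Z" "m = cmod (c0 p)" by blast
      have m0: "m > 0" using c0(1) m by (metis norm_le_zero_iff not_le order.trans)
      \<comment> \<open>Chosen so that coefficients of modulus at most \<open>t\<close> give norm at
        most 1: the derivative is bounded by \<open>N * t * (N * D)\<close>, and \<open>F\<close>
        turns this into a bound on the norm. After scaling, the coefficient at \<open>p\<close> has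
        modulus exactly \<open>t\<close>.\<close>
      define t where "t = 1 / (F * D * (real N)\<^sup>2)"
      have t: "t > 0" using F D N by (simp add: t_def)
      define c where "c k = of_real (t / m) * c0 k" for k
      have c: "cmod (c k) \<le> t" if "k \<in> Z" for k
        using m[OF that] m0 t by (simp add: c_def norm_mult norm_divide field_simps)
      have cp: "cmod (c p) = t"
        using m0 t p by (simp add: c_def norm_mult norm_divide)
      define f where "f = (\<lambda>w. \<Sum>k\<in>Z. c k * B k w)"
      have fH: "f \<in> Hw \<omega>" unfolding f_def by (rule comb)
      have csum: "(\<Sum>k\<in>Z. cmod (c k)) \<le> real N * t"
        unfolding N_def using c by (intro sum_bounded_above) auto
      have "wnorm \<omega> f \<le> ennreal (F * (real N * t * (real N * D)))"
      proof (rule F(2))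
        have "cmod (f 0) \<le> (\<Sum>k\<in>Z. cmod (c k))"
          unfolding f_def using B1[of 0] by (intro sum_norm_le) (auto simp: norm_mult mult_left_le)
        also have "\<dots> \<le> real N * t * 1" using csum by simp
        also have "\<dots> \<le> real N * t * (real N * D)"
          using N D t by (intro mult_left_mono) (auto intro: order_trans[OF _ mult_mono[of 1 _ 1]])
        finally show "cmod (f 0) \<le> real N * t * (real N * D)" .
        show "\<forall>z\<in>unit_disc. cmod (deriv f z) \<le> real N * t * (real N * D)"
        proof
          fix z :: complex assume z: "z \<in> unit_disc"
          have "cmod (deriv f z) \<le> (\<Sum>k\<in>Z. cmod (c k)) * (real N * D)"
            unfolding f_def by (rule comb_deriv[OF z])
          also have "\<dots> \<le> real N * t * (real N * D)"
            using csum D by (intro mult_right_mono) auto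
          finally show "cmod (deriv f z) \<le> real N * t * (real N * D)" .
        qed
      qed
      also have "F * (real N * t * (real N * D)) = 1"
        using F D N by (simp add: t_def power2_eq_square)
      finally have f1: "wnorm \<omega> f \<le> 1" by simp
      have Rf: "R f z = 0" if z: "z \<in> unit_disc" for z
      proof -
        have "R f z = (\<Sum>k\<in>Z. c k * R (B k) z)"
          unfolding f_def by (rule rank_less_ops_sum[OF R Z(1) BH comb z])
        also have "\<dots> = (\<Sum>k\<in>Z. \<Sum>i<N-1. c k * (M k i * gs i z))"
          using M[OF z] by (simp add: sum_distrib_left)
        also have "\<dots> = (\<Sum>i<N-1. \<Sum>k\<in>Z. c k * (M k i * gs i z))"
          by (rule sum.swap)
        also have "\<dots> = (\<Sum>i<N-1. of_real (t / m) * gs i z * (\<Sum>k\<in>Z. M k i * c0 k))"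
          by (simp add: c_def sum_distrib_left sum_divide_distrib mult_ac)
        also have "\<dots> = 0" using c0(2) by simp
        finally show ?thesis .
      qed
      obtain \<zeta> where \<zeta>: "cmod \<zeta> \<le> s" "p = \<phi> \<zeta>"
        using p(1) Z(3) s(3) by auto
      \<comment> \<open>Every \<open>B k\<close> with \<open>k \<noteq> p\<close> has a zero at
        \<open>p\<close>, so evaluation there isolates the largest coefficient.\<close>
      have fp: "f p = c p * B p p"
      proof -
        have "B k p = 0" if "k \<in> Z - {p}" for k
          using that p(1) Z(1) unfolding B_def blaschke_def by (intro prod_zero) auto
        then show ?thesis
          unfolding f_def using p(1) Z(1) by (simp add: sum.remove)
      qed
      have "exp (- S) \<le> cmod (B p p)"
        unfolding B_def by (rule blaschke_lower_bound) (use Z(1) le_less_trans[OF Zr r(2)] p pot S in auto)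
      then have "t * exp (- S) \<le> cmod (f p)"
        unfolding fp norm_mult cp using t by (intro mult_left_mono) auto
      also have "\<dots> = cmod (comp_op \<phi> f \<zeta>)" by (simp add: comp_op_def \<zeta>)
      also have "\<dots> \<le> E * enn2real (wnorm \<omega> (comp_op \<phi> f))"
        by (rule E(2)[OF comp_op_bounded(1)[OF \<omega> \<phi> r fH] \<zeta>(1)])
      finally have "exp (- S) / (C * (real N)\<^sup>2) \<le> enn2real (wnorm \<omega> (comp_op \<phi> f))"
        using E F D N by (simp add: t_def C_def field_simps)
      then have "ennreal (exp (- S) / (C * (real N)\<^sup>2)) \<le> wnorm \<omega> (comp_op \<phi> f)"
        using comp_op_bounded(1)[OF \<omega> \<phi> r fH] by (simp add: wnorm_Hw ennreal_leI)
      also have "\<dots> = wnorm \<omega> (\<lambda>z. comp_op \<phi> f z - R f z)"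
        by (rule wnorm_cong) (simp add: Rf)
      also have "\<dots> \<le> op_norm \<omega> (\<lambda>f z. comp_op \<phi> f z - R f z)"
        using op_norm_ge[OF fH f1, of "\<lambda>f z. comp_op \<phi> f z - R f z"] by simp
      finally show "ennreal (exp (- S) / (C * (real (card Z))\<^sup>2)) \<le> op_norm \<omega> (\<lambda>f z. comp_op \<phi> f z - R f z)"
        by (simp add: N_def)
    qed
  qed
qed

section \<open>Passage to the limit\<close>

text \<open>For a single measure of finite energy: the factor \<open>1 + 2 * \<delta>\<close> is the
  price of replacing \<open>n\<close> by a nearby \<open>N + 1\<close>, and
  \<open>V + \<delta>\<close> bounds the potentials per point.\<close>

lemma liminf_approx_num_ge_energy:
  assumes \<omega>: "admissible_weight \<omega>" and \<phi>: "\<phi> \<in> Hw \<omega>"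
    and r: "0 \<le> r" "r < 1" "\<And>z. z \<in> unit_disc \<Longrightarrow> cmod (\<phi> z) \<le> r"
    and K: "compact K" "K \<subseteq> \<phi> ` unit_disc"
    and \<mu>: "prob_space \<mu>" "sets \<mu> = sets borel" "emeasure \<mu> K = 1"
    and V: "V \<ge> 0" "green_energy \<mu> = ennreal V" and \<delta>: "0 < \<delta>" "\<delta> \<le> 1"
  shows "ereal (exp (- ((1 + 2 * \<delta>) * (V + \<delta>)))) \<le>
    liminf (\<lambda>n. ereal (enn2real (approx_num \<omega> (comp_op \<phi>) n) powr (1 / real n)))"
proof -
  define a where "a n = enn2real (approx_num \<omega> (comp_op \<phi>) n)" for n
  \<comment> \<open>At \<open>n = 0\<close> there are no competitors and the infimum is
    \<open>top\<close>; from \<open>n = 1\<close> on the numbers are finite.\<close>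
  have a: "approx_num \<omega> (comp_op \<phi>) n = ennreal (a n)" if "n \<ge> 1" for n
    unfolding a_def
    using le_less_trans[OF approx_num_le_op_norm[OF \<omega> that] comp_op_bounded(2)[OF \<omega> \<phi> r]]
    by simp
  obtain C where C: "C > 0"
    "\<And>Z S. finite Z \<Longrightarrow> Z \<noteq> {} \<Longrightarrow> Z \<subseteq> K \<Longrightarrow> S \<ge> 0 \<Longrightarrow>
      \<forall>k\<in>Z. (\<Sum>w\<in>Z - {k}. green k w) \<le> ennreal S \<Longrightarrow>
      ennreal (exp (- S) / (C * (real (card Z))\<^sup>2)) \<le> approx_num \<omega> (comp_op \<phi>) (card Z)"
    by (rule approx_num_lower_bound[OF \<omega> \<phi> r K], assumption) (rule that)
  have K_sets: "K \<in> sets borel" using K(1) by (intro borel_closed compact_imp_closed)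
  have le: "min_energy K N \<le> ennreal (real (N * (N - 1)) * V)" for N
    using min_energy_le[OF \<mu>(1,2) K_sets \<mu>(3), of N] V
    by (simp add: ennreal_mult' ennreal_of_nat_eq_real_of_nat)
  define e where "e N = enn2real (min_energy K N)" for N
  have e: "min_energy K N = ennreal (e N)" "e N \<ge> 0" for N
    using le_less_trans[OF le[of N]] by (auto simp: e_def)
  have e_le: "e N \<le> real (N * (N - 1)) * V" for N
    using le[of N] V(1) unfolding e(1) by (subst (asm) ennreal_le_iff) auto
  have e_mono: "real (Suc N) * e N \<le> real (N - 1) * e (Suc N)" if "N \<ge> 2" for N
  proof -
    have "ennreal (real (Suc N) * e N) \<le> ennreal (real (N - 1) * e (Suc N))"
      using min_energy_Suc[OF that, of K] e(2)
      by (simp only: e(1) ennreal_of_nat_eq_real_of_nat ennreal_mult)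
    then show ?thesis using e(2) by (subst (asm) ennreal_le_iff) auto
  qed
  have "\<forall>\<^sub>F n in sequentially. \<exists>N\<ge>n. real (Suc N) \<le> (1 + 2 * \<delta>) * real n \<and>
      (e (Suc N) - e N) / 2 \<le> real (Suc N) * (V + \<delta>)"
    using e_mono e_le V(1) \<delta> by (rule small_increment_in_window)
  \<comment> \<open>The factor \<open>exp (- 1)\<close> absorbs the additive constant in the bound
    for \<open>S\<close>, and 9 comes from squaring \<open>N + 1 \<le> 3 * n\<close>.\<close>
  then have "\<forall>\<^sub>F n in sequentially. exp (- ((1 + 2 * \<delta>) * (V + \<delta>))) * (exp (- 1) / (9 * C * (real n)\<^sup>2)) powr (1 / real n)
      \<le> a n powr (1 / real n)"
    using eventually_ge_at_top[of 1]
  proof eventually_elim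
    case (elim n)
    then obtain N where N: "n \<le> N" "real (Suc N) \<le> (1 + 2 * \<delta>) * real n"
      "(e (Suc N) - e N) / 2 \<le> real (Suc N) * (V + \<delta>)"
      by auto
    \<comment> \<open>Half the energy increment with the slack of the near-minimiser, truncated at 0
      to meet the sign condition of the lower bound.\<close>
    define S where "S = max 0 ((e (Suc N) - e N + 1) / 2)"
    have "min_energy K (Suc N) < top" by (simp add: e(1))
    then obtain Z where Z: "finite Z" "Z \<subseteq> K" "card Z = Suc N"
      "\<forall>k\<in>Z. min_energy K N + 2 * (\<Sum>z\<in>Z - {k}. green k z) \<le> min_energy K (Suc N) + 1"
      by (rule near_minimiser_potential) (rule that)
    have pot: "(\<Sum>z\<in>Z - {k}. green k z) \<le> ennreal S" if "k \<in> Z" for k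
    proof (cases "\<Sum>z\<in>Z - {k}. green k z")
      case (real x)
      then have "ennreal (e N + 2 * x) \<le> ennreal (e (Suc N) + 1)"
        using bspec[OF Z(4) that] e(2) by (simp add: e(1) ennreal_mult' flip: ennreal_numeral)
      then have "e N + 2 * x \<le> e (Suc N) + 1"
        using e(2)[of "Suc N"] by (subst (asm) ennreal_le_iff) auto
      then have "x \<le> S" unfolding S_def by (intro max.coboundedI2) simp
      then show ?thesis using real by (simp add: ennreal_leI)
    next
      case top
      then show ?thesis using bspec[OF Z(4) that] by (simp add: e(1) ennreal_mult_top top_unique flip: ennreal_1 ennreal_plus)
    qed
    have "S \<le> real (Suc N) * (V + \<delta>) + 1"
      using N(3) V(1) \<delta> by (auto simp: S_def)
    also have "\<dots> \<le> (1 + 2 * \<delta>) * real n * (V + \<delta>) + 1"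
      using N(2) V(1) \<delta> by (intro add_right_mono mult_right_mono) auto
    finally have S: "S \<le> (1 + 2 * \<delta>) * (V + \<delta>) * real n + 1" by (simp add: mult_ac)
    have "real (Suc N) \<le> 3 * real n"
      using N(2) \<delta>(2) mult_right_mono[of "1 + 2 * \<delta>" 3 "real n"] by simp
    then have N3: "(real (Suc N))\<^sup>2 \<le> 9 * (real n)\<^sup>2"
      using power_mono[of "real (Suc N)" "3 * real n" 2] by (simp add: power_mult_distrib)
    have "Z \<noteq> {}" using Z(3) by auto
    then have "ennreal (exp (- S) / (C * (real (Suc N))\<^sup>2)) \<le> approx_num \<omega> (comp_op \<phi>) (Suc N)"
      using C(2)[of Z S] Z(1-3) pot by (simp add: S_def)
    also have "\<dots> \<le> approx_num \<omega> (comp_op \<phi>) n"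
      using N(1) by (intro approx_num_antimono \<omega>) simp
    finally have "exp (- S) / (C * (real (Suc N))\<^sup>2) \<le> a n"
      unfolding a[OF elim(2)] by (subst (asm) ennreal_le_iff) (simp_all add: a_def)
    moreover have "exp (- ((1 + 2 * \<delta>) * (V + \<delta>) * real n + 1)) / (9 * C * (real n)\<^sup>2)
        \<le> exp (- S) / (C * (real (Suc N))\<^sup>2)"
      using S N3 C(1) elim(2) by (intro frac_le) auto
    moreover have "exp (- ((1 + 2 * \<delta>) * (V + \<delta>))) powr real n * (exp (- 1) / (9 * C * (real n)\<^sup>2))
        = exp (- ((1 + 2 * \<delta>) * (V + \<delta>) * real n + 1)) / (9 * C * (real n)\<^sup>2)"
      by (simp add: powr_def mult_ac flip: exp_add)
    ultimately have "exp (- ((1 + 2 * \<delta>) * (V + \<delta>))) powr real n * (exp (- 1) / (9 * C * (real n)\<^sup>2)) \<le> a n"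
      by linarith
    then have "(exp (- ((1 + 2 * \<delta>) * (V + \<delta>))) powr real n * (exp (- 1) / (9 * C * (real n)\<^sup>2))) powr (1 / real n)
        \<le> a n powr (1 / real n)"
      using C(1) by (intro powr_mono2) auto
    also have "(exp (- ((1 + 2 * \<delta>) * (V + \<delta>))) powr real n * (exp (- 1) / (9 * C * (real n)\<^sup>2))) powr (1 / real n)
       = exp (- ((1 + 2 * \<delta>) * (V + \<delta>))) * (exp (- 1) / (9 * C * (real n)\<^sup>2)) powr (1 / real n)"
      using C(1) elim(2) by (subst powr_mult) (auto simp: powr_powr)
    finally show ?case .
  qed
  then have "liminf (\<lambda>n. ereal (exp (- ((1 + 2 * \<delta>) * (V + \<delta>))) * (exp (- 1) / (9 * C * (real n)\<^sup>2)) powr (1 / real n)))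
      \<le> liminf (\<lambda>n. ereal (a n powr (1 / real n)))"
    by (intro Liminf_mono) simp
  \<comment> \<open>The polynomial loss disappears under the \<open>n\<close>-th root.\<close>
  moreover have "(\<lambda>n. (exp (- 1) / (9 * C * (real n)\<^sup>2)) powr (1 / real n)) \<longlonglongrightarrow> 1"
    using C(1) by real_asymp
  then have "(\<lambda>n. ereal (exp (- ((1 + 2 * \<delta>) * (V + \<delta>))) * (exp (- 1) / (9 * C * (real n)\<^sup>2)) powr (1 / real n)))
      \<longlonglongrightarrow> ereal (exp (- ((1 + 2 * \<delta>) * (V + \<delta>))) * 1)"
    by (intro tendsto_intros)
  then have "liminf (\<lambda>n. ereal (exp (- ((1 + 2 * \<delta>) * (V + \<delta>))) * (exp (- 1) / (9 * C * (real n)\<^sup>2)) powr (1 / real n)))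
      = ereal (exp (- ((1 + 2 * \<delta>) * (V + \<delta>))) * 1)"
    by (intro lim_imp_Liminf) auto
  ultimately show ?thesis by (simp add: a_def)
qed

theorem theorem3p10:
  fixes \<omega> :: "real \<Rightarrow> real" and \<phi> :: "complex \<Rightarrow> complex"
  assumes "admissible_weight \<omega>"
    and "\<phi> \<in> Hw \<omega>"
    and "\<phi> ` unit_disc \<subseteq> unit_disc"
    and "(SUP z \<in> unit_disc. cmod (\<phi> z)) < 1"
  shows "liminf (\<lambda>n. ereal (enn2real (approx_num \<omega> (comp_op \<phi>) n) powr (1 / real n)))
         \<ge> ereal (if green_cap (\<phi> ` unit_disc) = 0 then 0
                  else exp (- (1 / enn2real (green_cap (\<phi> ` unit_disc)))))"
proof -
  let ?L = "liminf (\<lambda>n. ereal (enn2real (approx_num \<omega> (comp_op \<phi>) n) powr (1 / real n)))"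
  obtain r where r: "0 \<le> r" "r < 1" "\<forall>z\<in>unit_disc. cmod (\<phi> z) \<le> r"
    by (rule sup_disc_bound[OF assms(3,4)]) (rule that)
  have nonneg: "ereal 0 \<le> ?L"
    by (rule Liminf_bounded) simp
  show ?thesis
  proof (cases "green_V (\<phi> ` unit_disc)")
    \<comment> \<open>Infinite minimal energy means capacity 0, and the bound reduces to
      nonnegativity.\<close>
    case top
    then show ?thesis using nonneg by (simp add: green_cap_def)
  next
    case (real V)
    \<comment> \<open>For \<open>V = 0\<close> the capacity is infinite, \<open>enn2real\<close>
      sends it to 0, and real division by 0 again gives \<open>0 = V\<close>.\<close>
    have cap: "green_cap (\<phi> ` unit_disc) \<noteq> 0" "1 / enn2real (green_cap (\<phi> ` unit_disc)) = V"
      using real unfolding green_cap_def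
      by (cases "V = 0"; simp add: divide_ennreal[of 1, simplified] ennreal_divide_eq_0_iff)+
    \<comment> \<open>The slack \<open>\<delta>\<close> is spent twice: in choosing a measure of
      energy below \<open>V + \<delta>\<close>, and in the bound for that measure.\<close>
    have *: "ereal (exp (- ((1 + 2 * \<delta>) * (V + 2 * \<delta>)))) \<le> ?L" if \<delta>: "0 < \<delta>" "\<delta> \<le> 1" for \<delta>
    proof -
      have "green_V (\<phi> ` unit_disc) < ennreal (V + \<delta>)"
        using real \<delta> by (simp add: ennreal_less_iff)
      then obtain \<mu> K where \<mu>: "prob_space \<mu>" "sets \<mu> = sets borel" "green_energy \<mu> < ennreal (V + \<delta>)"
        and K: "compact K" "K \<subseteq> \<phi> ` unit_disc" "emeasure \<mu> K = 1"
        unfolding green_V_def INF_less_iff by auto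
      obtain I where I: "I \<ge> 0" "green_energy \<mu> = ennreal I"
        using \<mu>(3) by (cases "green_energy \<mu>") auto
      have "I \<le> V + \<delta>"
        using \<mu>(3) I by (simp add: ennreal_less_iff)
      then have "(1 + 2 * \<delta>) * (I + \<delta>) \<le> (1 + 2 * \<delta>) * (V + 2 * \<delta>)"
        using \<delta> by (intro mult_left_mono) auto
      then have "ereal (exp (- ((1 + 2 * \<delta>) * (V + 2 * \<delta>)))) \<le> ereal (exp (- ((1 + 2 * \<delta>) * (I + \<delta>))))"
        by simp
      also have "\<dots> \<le> ?L"
        by (rule liminf_approx_num_ge_energy[OF assms(1,2) r(1,2) bspec[OF r(3)] K(1,2) \<mu>(1,2) K(3) I \<delta>])
      finally show ?thesis .
    qed
    have "ereal (exp (- V)) \<le> ?L"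
    proof (rule tendsto_upperbound)
      have "((\<lambda>\<delta>. ereal (exp (- ((1 + 2 * \<delta>) * (V + 2 * \<delta>))))) \<longlongrightarrow>
          ereal (exp (- ((1 + 2 * 0) * (V + 2 * 0))))) (at_right 0)"
        by (intro tendsto_intros)
      then show "((\<lambda>\<delta>. ereal (exp (- ((1 + 2 * \<delta>) * (V + 2 * \<delta>))))) \<longlongrightarrow> ereal (exp (- V))) (at_right 0)"
        by simp
      show "\<forall>\<^sub>F \<delta> in at_right 0. ereal (exp (- ((1 + 2 * \<delta>) * (V + 2 * \<delta>)))) \<le> ?L"
        using eventually_at_right_real[of 0 1] by (rule eventually_mono) (use * in auto)
    qed simp
    then show ?thesis using cap by simp
  qed
qed

end
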